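(* Let $p>2$ be prime, $S$ a free profinite group, $N$ a closed normal subgroup of $S$ contained in $S^{(2,p)}$, and $G=S/N$. Then $T^{\mathbb{Z}/p^2}(G)\cap T^{M_{p^3}}(G)=G^{(3,p)}$ if and only if $G$ satisfies the Bockstein-cup kernel condition: the kernel of $\inf\colon H^2(G/G^{(2,p)})\to H^2(G)$ is generated by those of its elements that are of the form $\operatorname{Bock}(\varphi)+\varphi\cup\psi$ with $\varphi,\psi\in H^1(G/G^{(2,p)})$.
   Context: For profinite groups $\mathbb{U}$ and $G$, $T^{\mathbb{U}}(G)$ denotes the intersection of the kernels of all continuous homomorphisms $G\to\mathbb{U}$. $M_{p^3}=\langle r,s\mid r^{p^2}=s^p=1,\ [r,s]=r^p\rangle$ is the extra-special group of order $p^3$ and exponent $p^2$. Cohomology is $H^i(\cdot)=H^i(\cdot,\mathbb{Z}/p)$ with trivial action; $\operatorname{Bock}$ is the Bockstein homomorphism $H^1\to H^2$, i.e. the connecting map for $0\to\mathbb{Z}/p\to\mathbb{Z}/p^2\to\mathbb{Z}/p\to0$. The lower $p$-central filtration is $G^{(1,p)}=G$, $G^{(k+1,p)}=(G^{(k,p)})^p[G,G^{(k,p)}]$ (closed subgroups generated). *)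

theory Defs
  imports "HOL-Algebra.Algebra" "HOL-Analysis.Analysis"
begin

definition topological_group :: "('g, 'b) monoid_scheme \<Rightarrow> 'g topology \<Rightarrow> bool" where
  "topological_group G T \<longleftrightarrow> group G \<and> topspace T = carrier G
     \<and> continuous_map (prod_topology T T) T (\<lambda>(x, y). x \<otimes>\<^bsub>G\<^esub> y)
     \<and> continuous_map T T (m_inv G)"

definition profinite_group :: "('g, 'b) monoid_scheme \<Rightarrow> 'g topology \<Rightarrow> bool" where
  "profinite_group G T \<longleftrightarrow> topological_group G T \<and> compact_space T \<and> Hausdorff_space T
     \<and> (\<forall>x \<in> topspace T. connected_component_of_set T x = {x})"

definition closed_gen :: "('g, 'b) monoid_scheme \<Rightarrow> 'g topology \<Rightarrow> 'g set \<Rightarrow> 'g set" where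
  "closed_gen G T A = \<Inter> {H. subgroup H G \<and> closedin T H \<and> A \<subseteq> H}"

text \<open>Free profinite group on a set A (Fried--Jarden): iota converges to 1, the image of iota
  topologically generates S, and every map from A to a finite group sending almost all
  elements to 1 extends to a continuous homomorphism. (Every finite group is isomorphic
  to one whose carrier is a set of naturals, so quantifying over nat-carried groups suffices.)\<close>
definition free_profinite ::
  "('s, 'b) monoid_scheme \<Rightarrow> 's topology \<Rightarrow> 'x set \<Rightarrow> ('x \<Rightarrow> 's) \<Rightarrow> bool" where
  "free_profinite S T A iota \<longleftrightarrow> profinite_group S T \<and> iota ` A \<subseteq> carrier S
     \<and> (\<forall>U. openin T U \<and> one S \<in> U \<longrightarrow> finite {x \<in> A. iota x \<notin> U})
     \<and> closed_gen S T (iota ` A) = carrier S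
     \<and> (\<forall>(H :: nat monoid) f. group H \<and> finite (carrier H) \<and> f ` A \<subseteq> carrier H
          \<and> finite {x \<in> A. f x \<noteq> one H} \<longrightarrow>
          (\<exists>\<phi>. \<phi> \<in> hom S H \<and> continuous_map T (discrete_topology (carrier H)) \<phi>
                \<and> (\<forall>x \<in> A. \<phi> (iota x) = f x)))"

definition comm :: "('g, 'b) monoid_scheme \<Rightarrow> 'g \<Rightarrow> 'g \<Rightarrow> 'g" where
  "comm G g h = inv\<^bsub>G\<^esub> g \<otimes>\<^bsub>G\<^esub> inv\<^bsub>G\<^esub> h \<otimes>\<^bsub>G\<^esub> g \<otimes>\<^bsub>G\<^esub> h"

text \<open>lpc G T p k = G^{(k,p)} for k \<ge> 1 (G^{(1,p)} = G; index 0 is set to G as well, unused).\<close>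
fun lpc :: "('g, 'b) monoid_scheme \<Rightarrow> 'g topology \<Rightarrow> nat \<Rightarrow> nat \<Rightarrow> 'g set" where
  "lpc G T p 0 = carrier G"
| "lpc G T p (Suc k) = (if k = 0 then carrier G else
     closed_gen G T ({x [^]\<^bsub>G\<^esub> p | x. x \<in> lpc G T p k}
                     \<union> {comm G g h | g h. g \<in> carrier G \<and> h \<in> lpc G T p k}))"

definition Zmod_p2 :: "nat \<Rightarrow> int monoid" where
  "Zmod_p2 p = \<lparr>carrier = {0..<int p ^ 2}, monoid.mult = (\<lambda>a b. (a + b) mod (int p ^ 2)), one = 0\<rparr>"

text \<open>M_{p^3} realised as Z/p^2 \<rtimes> Z/p, (a,b) = r^a s^b, with s r s^{-1} = r^{1+p};
  it is generated by r = (1,0) of order p^2 and s = (0,1) of order p with commutator a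
  power r^{\<plusminus>p}, so it is the extra-special group of order p^3 and exponent p^2.\<close>
definition Mp3 :: "nat \<Rightarrow> (int \<times> int) monoid" where
  "Mp3 p = \<lparr>carrier = {0..<int p ^ 2} \<times> {0..<int p},
     monoid.mult = (\<lambda>(a, b) (c, d). ((a + c * (1 + int p * b)) mod (int p ^ 2), (b + d) mod int p)),
     one = (0, 0)\<rparr>"

definition T_of :: "('g, 'b) monoid_scheme \<Rightarrow> 'g topology \<Rightarrow> ('u, 'c) monoid_scheme \<Rightarrow> 'g set" where
  "T_of G T U = \<Inter> {kernel G U f | f. f \<in> hom G U
                      \<and> continuous_map T (discrete_topology (carrier U)) f}"

text \<open>Z/p is represented by {0..<p} \<subseteq> int. Cochains are extended by 0 outside the carrier.\<close>

definition H1 :: "('g, 'b) monoid_scheme \<Rightarrow> 'g topology \<Rightarrow> nat \<Rightarrow> ('g \<Rightarrow> int) set" where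
  "H1 G T p = {\<phi>. continuous_map T (discrete_topology {0..<int p}) \<phi>
      \<and> (\<forall>x. x \<notin> carrier G \<longrightarrow> \<phi> x = 0)
      \<and> (\<forall>x \<in> carrier G. \<forall>y \<in> carrier G. \<phi> (x \<otimes>\<^bsub>G\<^esub> y) = (\<phi> x + \<phi> y) mod int p)}"

definition Z2 :: "('g, 'b) monoid_scheme \<Rightarrow> 'g topology \<Rightarrow> nat \<Rightarrow> ('g \<Rightarrow> 'g \<Rightarrow> int) set" where
  "Z2 G T p = {f. continuous_map (prod_topology T T) (discrete_topology {0..<int p}) (\<lambda>(x, y). f x y)
      \<and> (\<forall>x y. x \<notin> carrier G \<or> y \<notin> carrier G \<longrightarrow> f x y = 0)
      \<and> (\<forall>g \<in> carrier G. \<forall>h \<in> carrier G. \<forall>k \<in> carrier G.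
           (f h k - f (g \<otimes>\<^bsub>G\<^esub> h) k + f g (h \<otimes>\<^bsub>G\<^esub> k) - f g h) mod int p = 0)}"

definition cobdry :: "('g, 'b) monoid_scheme \<Rightarrow> nat \<Rightarrow> ('g \<Rightarrow> int) \<Rightarrow> 'g \<Rightarrow> 'g \<Rightarrow> int" where
  "cobdry G p c = (\<lambda>x y. if x \<in> carrier G \<and> y \<in> carrier G
      then (c y - c (x \<otimes>\<^bsub>G\<^esub> y) + c x) mod int p else 0)"

definition B2 :: "('g, 'b) monoid_scheme \<Rightarrow> 'g topology \<Rightarrow> nat \<Rightarrow> ('g \<Rightarrow> 'g \<Rightarrow> int) set" where
  "B2 G T p = {cobdry G p c | c. continuous_map T (discrete_topology {0..<int p}) c}"

definition Z2grp :: "('g, 'b) monoid_scheme \<Rightarrow> 'g topology \<Rightarrow> nat \<Rightarrow> ('g \<Rightarrow> 'g \<Rightarrow> int) monoid" where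
  "Z2grp G T p = \<lparr>carrier = Z2 G T p, monoid.mult = (\<lambda>f g x y. (f x y + g x y) mod int p),
                  one = (\<lambda>x y. 0)\<rparr>"

definition H2 :: "('g, 'b) monoid_scheme \<Rightarrow> 'g topology \<Rightarrow> nat \<Rightarrow> ('g \<Rightarrow> 'g \<Rightarrow> int) set monoid" where
  "H2 G T p = Z2grp G T p Mod B2 G T p"

definition cls :: "('g, 'b) monoid_scheme \<Rightarrow> 'g topology \<Rightarrow> nat \<Rightarrow> ('g \<Rightarrow> 'g \<Rightarrow> int)
                   \<Rightarrow> ('g \<Rightarrow> 'g \<Rightarrow> int) set" where
  "cls G T p f = B2 G T p #>\<^bsub>Z2grp G T p\<^esub> f"

text \<open>Bockstein: connecting map of 0 \<rightarrow> Z/p \<rightarrow> Z/p^2 \<rightarrow> Z/p \<rightarrow> 0, computed with the lift of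
  \<phi> to values {0..<p} \<subseteq> Z/p^2; cup product in degree (1,1).\<close>
definition bock :: "('g, 'b) monoid_scheme \<Rightarrow> nat \<Rightarrow> ('g \<Rightarrow> int) \<Rightarrow> 'g \<Rightarrow> 'g \<Rightarrow> int" where
  "bock G p \<phi> = (\<lambda>x y. if x \<in> carrier G \<and> y \<in> carrier G
      then ((\<phi> x + \<phi> y - \<phi> (x \<otimes>\<^bsub>G\<^esub> y)) div int p) mod int p else 0)"

definition cup :: "('g, 'b) monoid_scheme \<Rightarrow> nat \<Rightarrow> ('g \<Rightarrow> int) \<Rightarrow> ('g \<Rightarrow> int) \<Rightarrow> 'g \<Rightarrow> 'g \<Rightarrow> int" where
  "cup G p \<phi> \<psi> = (\<lambda>x y. if x \<in> carrier G \<and> y \<in> carrier G then (\<phi> x * \<psi> y) mod int p else 0)"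

definition infl :: "('h, 'c) monoid_scheme \<Rightarrow> ('g, 'b) monoid_scheme \<Rightarrow> 'g topology \<Rightarrow> nat
                    \<Rightarrow> ('g \<Rightarrow> 'h) \<Rightarrow> ('h \<Rightarrow> 'h \<Rightarrow> int) set \<Rightarrow> ('g \<Rightarrow> 'g \<Rightarrow> int) set" where
  "infl Q G TG p q C = cls G TG p (let f = (SOME f. f \<in> C) in
      (\<lambda>x y. if x \<in> carrier G \<and> y \<in> carrier G then f (q x) (q y) else 0))"

text \<open>Bockstein-cup kernel condition, for Q = G/G^{(2,p)} with quotient map q.\<close>
definition bock_cup_kernel_condition ::
  "('h, 'c) monoid_scheme \<Rightarrow> 'h topology \<Rightarrow> ('g, 'b) monoid_scheme \<Rightarrow> 'g topology
   \<Rightarrow> nat \<Rightarrow> ('g \<Rightarrow> 'h) \<Rightarrow> bool" where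
  "bock_cup_kernel_condition Q TQ G TG p q \<longleftrightarrow>
     (let K = kernel (H2 Q TQ p) (H2 G TG p) (infl Q G TG p q) in
      K = generate (H2 Q TQ p)
            (K \<inter> {cls Q TQ p (\<lambda>x y. (bock Q p \<phi> x y + cup Q p \<phi> \<psi> x y) mod int p) | \<phi> \<psi>.
                    \<phi> \<in> H1 Q TQ p \<and> \<psi> \<in> H1 Q TQ p}))"

end

theory Submission
  imports Defs
begin

text \<open>Write \<open>\<Phi> = G\<^bsup>(2,p)\<^esup>\<close> and \<open>Q = G/\<Phi>\<close>. The transgression identifies the continuous
  homomorphisms \<open>\<Phi>/G\<^bsup>(3,p)\<^esup> \<rightarrow> \<int>/p\<close> with the kernel of the inflation \<open>H\<^sup>2(Q) \<rightarrow> H\<^sup>2(G)\<close>: if the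
  inflation of a cocycle f is the coboundary of c, then \<open>c - c(1)\<close> restricts to such a homomorphism.
  A homomorphism \<open>\<rho>\<close> from G to \<open>M\<^bsub>p\<^sup>3\<^esub>\<close> maps \<Phi> into the centre \<open>\<int>/p\<close>, and the restrictions of
  such \<open>\<rho>\<close> to \<Phi> are exactly the functionals that transgress to elements of the form
  \<open>Bock(\<phi>) + \<phi> \<union> \<psi>\<close>. As \<open>\<int>/p\<^sup>2\<close> embeds into \<open>M\<^bsub>p\<^sup>3\<^esub>\<close> and the homomorphisms \<open>G \<rightarrow> \<int>/p\<close> lift to
  \<open>M\<^bsub>p\<^sup>3\<^esub>\<close>, the intersection of the two T-subgroups is the common kernel of these functionals on \<Phi>.
  By Pontryagin duality for \<open>\<Phi>/G\<^bsup>(3,p)\<^esup>\<close> it equals \<open>G\<^bsup>(3,p)\<^esup>\<close> if and only if they generate all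
  functionals.\<close>

section \<open>Profinite groups\<close>

text \<open>Why Bock + cup: \<open>Mp3\<close> is a central extension of (Z/p)^2. Over the section
  that keeps (f, h) with 0 \<le> f < p, the product of (f1, h1) and (f2, h2) exceeds the section by
  r^(p (b + f2 h1)), where b is the carry of f1 + f2. So the extension class is Bock(f) + h \<union>
  f. Adding the coboundary of the function f h turns h \<union> f into -(f \<union> h), whence
  \<psi> is minus the second coordinate. Two obstacles are topological. A functional on \<Phi> has
  to be extended to a continuous cochain on G without a continuous section of the map from G to Q;
  an open subgroup U such that the functional is trivial on U \<inter> \<Phi> supplies a locally
  constant substitute. And \<Phi>/G^(3,p) may be infinite, so spanning cannot be checked by counting
  dimensions; but the subset of \<Phi> where a functional is nonzero is compact, which leaves
  finitely many functionals coming from \<open>Mp3\<close> to compare it with.\<close>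

lemma continuous_map_discrete_iff:
  "continuous_map T (discrete_topology D) c \<longleftrightarrow>
     c ` topspace T \<subseteq> D \<and> (\<forall>x\<in>topspace T. \<exists>U. openin T U \<and> x \<in> U \<and> (\<forall>y\<in>U. c y = c x))"
proof (intro iffI conjI ballI)
  assume c: "continuous_map T (discrete_topology D) c"
  show "c ` topspace T \<subseteq> D" using c by (auto simp: continuous_map_def)
  fix x assume x: "x \<in> topspace T"
  with c have "openin T {y \<in> topspace T. c y \<in> {c x}}"
    by (intro openin_continuous_map_preimage[OF c]) (auto simp: continuous_map_def)
  then show "\<exists>U. openin T U \<and> x \<in> U \<and> (\<forall>y\<in>U. c y = c x)"
    using x by blast
next
  assume *: "c ` topspace T \<subseteq> D \<and> (\<forall>x\<in>topspace T. \<exists>U. openin T U \<and> x \<in> U \<and> (\<forall>y\<in>U. c y = c x))"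
  have "openin T {x \<in> topspace T. c x \<in> U}" for U
  proof (subst openin_subopen, intro ballI, elim CollectE conjE)
    fix x assume "x \<in> topspace T" "c x \<in> U"
    with * obtain V where V: "openin T V" "x \<in> V" "\<forall>y\<in>V. c y = c x" by blast
    then have "V \<subseteq> {x \<in> topspace T. c x \<in> U}"
      using \<open>c x \<in> U\<close> openin_subset[OF V(1)] by (metis (mono_tags) mem_Collect_eq subset_iff)
    with V show "\<exists>V. openin T V \<and> x \<in> V \<and> V \<subseteq> {x \<in> topspace T. c x \<in> U}" by blast
  qed
  with * show "continuous_map T (discrete_topology D) c"
    by (auto simp: continuous_map_def)
qed

lemma continuous_map_discrete_range:
  "continuous_map T (discrete_topology D) c \<Longrightarrow> x \<in> topspace T \<Longrightarrow> c x \<in> D"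
  by (auto simp: continuous_map_def)

text \<open>Two locally constant functions are constant on a common neighbourhood, so any F may be
  applied to them; D only has to contain the results. The target \<open>UNIV\<close> admits
  unreduced integer intermediates.\<close>

lemma continuous_map_discrete_comp2:
  assumes a: "continuous_map T (discrete_topology A) a" and b: "continuous_map T (discrete_topology B) b"
    and D: "\<And>x. x \<in> topspace T \<Longrightarrow> F (a x) (b x) \<in> D"
  shows "continuous_map T (discrete_topology D) (\<lambda>x. F (a x) (b x))"
  unfolding continuous_map_discrete_iff
proof (intro conjI ballI)
  show "(\<lambda>x. F (a x) (b x)) ` topspace T \<subseteq> D" using D by auto
  fix x assume x: "x \<in> topspace T"
  obtain U V where "openin T U" "x \<in> U" "\<forall>y\<in>U. a y = a x" "openin T V" "x \<in> V" "\<forall>y\<in>V. b y = b x"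
    using a b x unfolding continuous_map_discrete_iff by meson
  then have "openin T (U \<inter> V) \<and> x \<in> U \<inter> V \<and> (\<forall>y\<in>U \<inter> V. F (a y) (b y) = F (a x) (b x))"
    by (metis IntD1 IntD2 IntI openin_Int)
  then show "\<exists>U. openin T U \<and> x \<in> U \<and> (\<forall>y\<in>U. F (a y) (b y) = F (a x) (b x))" by blast
qed

lemma continuous_map_discrete_comp1:
  assumes "continuous_map T (discrete_topology A) a"
    and "\<And>x. x \<in> topspace T \<Longrightarrow> F (a x) \<in> D"
  shows "continuous_map T (discrete_topology D) (\<lambda>x. F (a x))"
  using continuous_map_discrete_comp2[OF assms(1,1), of "\<lambda>x y. F x"] assms(2) by simp

lemma continuous_map_discrete_eq:
  assumes "continuous_map T (discrete_topology D) a" "\<And>x. x \<in> topspace T \<Longrightarrow> a x = b x"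
  shows "continuous_map T (discrete_topology D) b"
  using assms continuous_map_eq by blast

lemma closedin_discrete_vimage:
  assumes "continuous_map T (discrete_topology D) c"
  shows "closedin T {x \<in> topspace T. P (c x)}"
proof -
  have "closedin T {x \<in> topspace T. c x \<in> {d \<in> D. P d}}"
    using assms by (rule closedin_continuous_map_preimage) auto
  moreover have "{x \<in> topspace T. c x \<in> {d \<in> D. P d}} = {x \<in> topspace T. P (c x)}"
    using continuous_map_discrete_range[OF assms] by auto
  ultimately show ?thesis by simp
qed

lemma openin_discrete_vimage:
  assumes "continuous_map T (discrete_topology D) c"
  shows "openin T {x \<in> topspace T. P (c x)}"
proof -
  have "openin T {x \<in> topspace T. c x \<in> {d \<in> D. P d}}"
    using assms by (rule openin_continuous_map_preimage) auto
  moreover have "{x \<in> topspace T. c x \<in> {d \<in> D. P d}} = {x \<in> topspace T. P (c x)}"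
    using continuous_map_discrete_range[OF assms] by auto
  ultimately show ?thesis by simp
qed

text \<open>A connected set containing x is the point x, so none meets both x and the complement of
  W; in a compact Hausdorff space this already yields a clopen set separating the two
  (cut-wire-fence theorem).\<close>

lemma compact_totally_disconnected_clopen:
  assumes "compact_space T" "Hausdorff_space T"
    and "\<And>x. x \<in> topspace T \<Longrightarrow> connected_component_of_set T x = {x}"
    and "openin T W" "x \<in> W"
  obtains V where "openin T V" "closedin T V" "x \<in> V" "V \<subseteq> W"
proof -
  have x: "x \<in> topspace T" using assms(4,5) openin_subset by blast
  have "separated_between T {x} (topspace T - W)"
  proof (rule cut_wire_fence_theorem[OF assms(1,2)])
    show "closedin T {x}" using x assms(2) by (simp add: closedin_Hausdorff_singleton)
    show "closedin T (topspace T - W)" using assms(4) by blast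
    fix C assume C: "connectedin T C"
    show "disjnt C {x} \<or> disjnt C (topspace T - W)"
    proof (cases "x \<in> C")
      case True
      then have "C \<subseteq> {x}"
        using connected_component_of_maximal[OF C True] assms(3)[OF x] by simp
      then show ?thesis using assms(5) by (auto simp: disjnt_def)
    qed (auto simp: disjnt_def)
  qed
  then obtain U where U: "closedin T U" "openin T U" "{x} \<subseteq> U" "topspace T - W \<subseteq> topspace T - U"
    unfolding separated_between by blast
  moreover have "U \<subseteq> W" using U openin_subset by blast
  ultimately show thesis using that by blast
qed

section \<open>Topological and profinite groups\<close>

locale top_group = group G for G :: "('g, 'b) monoid_scheme" (structure) +
  fixes T :: "'g topology"
  assumes topological_group: "topological_group G T"
begin

lemma topspace_eq [simp]: "topspace T = carrier G"
  using topological_group by (simp add: topological_group_def)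

lemma continuous_map_mult: "continuous_map (prod_topology T T) T (\<lambda>(x, y). x \<otimes> y)"
  using topological_group by (simp add: topological_group_def)

lemma continuous_map_lmult:
  assumes "a \<in> carrier G" shows "continuous_map T T (\<lambda>x. a \<otimes> x)"
proof -
  have "continuous_map T (prod_topology T T) (\<lambda>x. (a, x))"
    using assms by (simp add: continuous_map_paired)
  from continuous_map_compose[OF this continuous_map_mult] show ?thesis by (simp add: o_def)
qed

lemma openin_lmult:
  assumes a: "a \<in> carrier G" and "openin T U" shows "openin T ((\<lambda>x. a \<otimes> x) ` U)"
proof -
  have U: "U \<subseteq> carrier G" using assms openin_subset by force
  have "(\<lambda>x. a \<otimes> x) ` U = {x \<in> topspace T. inv a \<otimes> x \<in> U}"
  proof (intro Set.set_eqI iffI)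
    fix x assume "x \<in> (\<lambda>x. a \<otimes> x) ` U"
    then show "x \<in> {x \<in> topspace T. inv a \<otimes> x \<in> U}" using a U by (auto simp: m_assoc[symmetric])
  next
    fix x assume x: "x \<in> {x \<in> topspace T. inv a \<otimes> x \<in> U}"
    then have "x = a \<otimes> (inv a \<otimes> x)" using a by (simp add: m_assoc[symmetric])
    with x show "x \<in> (\<lambda>x. a \<otimes> x) ` U" by blast
  qed
  then show ?thesis
    using openin_continuous_map_preimage[OF continuous_map_lmult[OF inv_closed[OF a]] assms(2)] by simp
qed

lemma subgroup_closed_gen: "A \<subseteq> carrier G \<Longrightarrow> subgroup (closed_gen G T A) G"
  unfolding closed_gen_def
  by (rule subgroups_Inter) (use subgroup_self closedin_topspace[of T] in auto)

lemma closedin_closed_gen: "A \<subseteq> carrier G \<Longrightarrow> closedin T (closed_gen G T A)"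
  unfolding closed_gen_def
  by (rule closedin_Inter) (use subgroup_self closedin_topspace[of T] in auto)

lemma closed_gen_superset: "A \<subseteq> closed_gen G T A"
  unfolding closed_gen_def by auto

lemma closed_gen_minimal:
  "subgroup H G \<Longrightarrow> closedin T H \<Longrightarrow> A \<subseteq> H \<Longrightarrow> closed_gen G T A \<subseteq> H"
  unfolding closed_gen_def by auto

end

locale profinite = top_group +
  assumes profinite_group: "profinite_group G T"
begin

lemma compact_space: "compact_space T" and Hausdorff_space: "Hausdorff_space T"
  and totally_disconnected: "x \<in> carrier G \<Longrightarrow> connected_component_of_set T x = {x}"
  using profinite_group by (auto simp: profinite_group_def)

text \<open>The right stabiliser of a clopen neighbourhood of 1 is an open subgroup inside it;
  its openness is the tube lemma.\<close>
lemma open_subgroup_in_nbhd: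
  assumes "openin T W" "\<one> \<in> W"
  obtains U where "subgroup U G" "openin T U" "U \<subseteq> W"
proof -
  obtain V where V: "openin T V" "closedin T V" "\<one> \<in> V" "V \<subseteq> W"
    using compact_totally_disconnected_clopen[OF compact_space Hausdorff_space _ assms] totally_disconnected
    by auto
  have VG: "V \<subseteq> carrier G" using V(1) openin_subset by force
  \<comment> \<open>Imposing the condition on g and on its inverse makes U closed under inverses;
    the elements with V g \<subseteq> V would a priori form only a monoid.\<close>
  define U where "U = {g \<in> carrier G. \<forall>v\<in>V. v \<otimes> g \<in> V \<and> v \<otimes> inv g \<in> V}"
  have sub: "subgroup U G"
  proof (rule subgroupI)
    have "\<one> \<in> U" using VG by (auto simp: U_def)
    then show "U \<noteq> {}" by blast
    fix a b assume ab: "a \<in> U" "b \<in> U"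
    then have "v \<otimes> (a \<otimes> b) \<in> V \<and> v \<otimes> inv (a \<otimes> b) \<in> V" if "v \<in> V" for v
      using that VG by (auto simp: U_def m_assoc[symmetric] inv_mult_group subset_iff)
    with ab show "a \<otimes> b \<in> U" by (auto simp: U_def)
  qed (use VG V(3) in \<open>auto simp: U_def\<close>)
  have "U \<subseteq> V"
  proof
    fix g assume "g \<in> U"
    then have "\<one> \<otimes> g \<in> V" "g \<in> carrier G" using V(3) by (auto simp: U_def)
    then show "g \<in> V" by simp
  qed
  have "compactin T V" using V(2) compact_space closedin_compact_space by blast
  have O: "openin (prod_topology T T) {z \<in> topspace (prod_topology T T). (case z of (x,y) \<Rightarrow> x \<otimes> y) \<in> V}"
    by (rule openin_continuous_map_preimage[OF continuous_map_mult V(1)])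
  obtain A B where AB: "openin T A" "openin T B" "V \<subseteq> A" "{\<one>} \<subseteq> B"
     "A \<times> B \<subseteq> {z \<in> topspace (prod_topology T T). (case z of (x,y) \<Rightarrow> x \<otimes> y) \<in> V}"
    by (rule Wallace_theorem_prod_topology[OF \<open>compactin T V\<close> _ O, of "{\<one>}"]) (use VG in auto)
  have "continuous_map T T (m_inv G)" using topological_group by (simp add: topological_group_def)
  then have C: "openin T {x \<in> topspace T. inv x \<in> B}" using AB(2) by (rule openin_continuous_map_preimage)
  define B' where "B' = B \<inter> {x \<in> topspace T. inv x \<in> B}"
  have VB: "v \<otimes> b \<in> V" if "v \<in> V" "b \<in> B" for v b
  proof -
    have "(v, b) \<in> A \<times> B" using that AB(3) by auto
    from subsetD[OF AB(5) this] show ?thesis by simp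
  qed
  have B': "openin T B'" "\<one> \<in> B'"
    using C AB(2,4) by (simp_all add: B'_def openin_Int)
  have B'U: "B' \<subseteq> U"
  proof
    fix b assume "b \<in> B'"
    then show "b \<in> U" using VB by (simp add: B'_def U_def)
  qed
  have "openin T U"
  proof (subst openin_subopen, intro ballI)
    fix u assume u: "u \<in> U"
    then have uG: "u \<in> carrier G" by (simp add: U_def)
    have "(\<lambda>x. u \<otimes> x) ` B' \<subseteq> U" using B'U u subgroup.m_closed[OF sub] by auto
    moreover have "u \<in> (\<lambda>x. u \<otimes> x) ` B'" using B'(2) uG by (force simp: image_iff)
    ultimately show "\<exists>W. openin T W \<and> u \<in> W \<and> W \<subseteq> U" using openin_lmult[OF uG B'(1)] by blast
  qed
  then show thesis using that sub \<open>U \<subseteq> V\<close> V(4) by blast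
qed

end

section \<open>Functionals on elementary abelian quotients\<close>

lemma bezout_prime:
  assumes "Factorial_Ring.prime p" "\<not> int p dvd i"
  obtains m n where "i * m + int p * n = 1"
proof -
  have "Factorial_Ring.prime (int p)" using assms(1) by simp
  then have "coprime i (int p)" using assms(2) prime_imp_coprime coprime_commute by blast
  then obtain m n where "m * i + n * int p = 1" using bezout_int[of i "int p"] by auto
  then show thesis using that[of m n] by (simp add: mult.commute)
qed

lemma (in group) int_pow_eq_one_of_dvd:
  assumes "x \<in> carrier G" "x [^] p = \<one>" "int p dvd i"
  shows "x [^] i = \<one>"
proof -
  obtain k where "i = int p * k" using assms(3) by blast
  then show ?thesis using int_pow_pow[OF assms(1), of "int p" k] assms(2) by (simp add: int_pow_int)
qed

text \<open>Zorn's lemma: the union of a nonempty chain of subgroups missing x again misses x. In an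
  elementary abelian group the maximal H is a complement of the line through x, which replaces the
  choice of a basis.\<close>

lemma (in group) maximal_subgroup_avoiding:
  assumes x: "x \<in> carrier G" "x \<noteq> \<one>"
  obtains H where "subgroup H G" "x \<notin> H" "\<And>K. subgroup K G \<Longrightarrow> H \<subseteq> K \<Longrightarrow> x \<notin> K \<Longrightarrow> K = H"
proof -
  define \<F> where "\<F> = {H. subgroup H G \<and> x \<notin> H}"
  have "\<exists>M\<in>\<F>. (\<forall>Y\<in>\<F>. M \<subseteq> Y \<longrightarrow> Y = M)"
  proof (rule subset_Zorn_nonempty)
    show "\<F> \<noteq> {}" using triv_subgroup x by (auto simp: \<F>_def)
    fix C assume C: "C \<noteq> {}" "subset.chain \<F> C"
    then have CF: "H \<in> \<F>" if "H \<in> C" for H using that by (auto simp: subset_chain_def)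
    have "subgroup (\<Union>C) G"
    proof (rule subgroupI)
      show "\<Union>C \<subseteq> carrier G" using CF unfolding \<F>_def by (blast dest: subgroup.subset)
      obtain H where "H \<in> C" using C by blast
      then show "\<Union>C \<noteq> {}" using CF unfolding \<F>_def by (blast dest: subgroup.one_closed)
      fix a assume "a \<in> \<Union>C"
      then show "inv a \<in> \<Union>C" using CF unfolding \<F>_def by (blast intro: subgroup.m_inv_closed)
      fix b assume "b \<in> \<Union>C"
      with \<open>a \<in> \<Union>C\<close> obtain A B where AB: "A \<in> C" "B \<in> C" "a \<in> A" "b \<in> B" by blast
      then obtain D where "D \<in> C" "a \<in> D" "b \<in> D"
        using C(2) unfolding subset_chain_def by (meson subsetD)
      then show "a \<otimes> b \<in> \<Union>C" using CF unfolding \<F>_def by (blast intro: subgroup.m_closed)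
    qed
    then show "\<Union>C \<in> \<F>" using CF by (auto simp: \<F>_def)
  qed
  then show thesis using that unfolding \<F>_def by blast
qed

text \<open>A maximal subgroup H avoiding x is a hyperplane: every y is h x^m with h in H and m
  unique modulo p, and \<theta> reads off m.\<close>

lemma (in comm_group) ex_functional_nonzero:
  assumes p: "Factorial_Ring.prime p" and ex: "\<And>y. y \<in> carrier G \<Longrightarrow> y [^] p = \<one>"
    and x: "x \<in> carrier G" "x \<noteq> \<one>"
  obtains \<theta> where "\<And>y. y \<in> carrier G \<Longrightarrow> \<theta> y \<in> {0..<int p}"
    "\<And>y z. y \<in> carrier G \<Longrightarrow> z \<in> carrier G \<Longrightarrow> int p dvd \<theta> (y \<otimes> z) - (\<theta> y + \<theta> z)" "\<theta> x \<noteq> 0"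
proof -
  obtain H where H: "subgroup H G" "x \<notin> H"
    and max: "\<And>K. subgroup K G \<Longrightarrow> H \<subseteq> K \<Longrightarrow> x \<notin> K \<Longrightarrow> K = H"
    using maximal_subgroup_avoiding[OF x] by blast
  note Hc = subgroup.mem_carrier[OF H(1)]
  \<comment> \<open>If y is outside H, maximality puts x into the product of H and the powers of y,
    say x = h y^i. Here p does not divide i, since otherwise x = h would lie in H; inverting i
    modulo p solves for y.\<close>
  have span: "\<exists>m::int. \<exists>h\<in>H. y = h \<otimes> x [^] m" if y: "y \<in> carrier G" for y
  proof (cases "y \<in> H")
    case True
    then show ?thesis using y by (intro exI[of _ 0] bexI[of _ y]) auto
  next
    case False
    define K where "K = H <#> generate G {y}"
    have sg: "subgroup (generate G {y}) G" by (rule generate_is_subgroup) (use y in simp)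
    have "subgroup K G" unfolding K_def by (rule mult_subgroups[OF H(1) sg])
    moreover have "H \<subseteq> K"
    proof
      fix h assume h: "h \<in> H"
      have "h \<otimes> \<one> \<in> K" unfolding K_def set_mult_def using h subgroup.one_closed[OF sg] by blast
      then show "h \<in> K" using Hc[OF h] by simp
    qed
    moreover have "y \<in> K"
    proof -
      have "\<one> \<otimes> y \<in> K" unfolding K_def set_mult_def
        using subgroup.one_closed[OF H(1)] generate.incl[of y "{y}" G] by blast
      then show "y \<in> K" using y by simp
    qed
    ultimately have "x \<in> K" using max False by blast
    then obtain h i where h: "h \<in> H" "x = h \<otimes> y [^] (i::int)"
      unfolding K_def set_mult_def generate_pow[OF y] by blast
    have "\<not> int p dvd i"
      using int_pow_eq_one_of_dvd[OF y ex[OF y], of i] h H(2) Hc by auto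
    then obtain m n where mn: "i * m + int p * n = 1" using bezout_prime[OF p] by blast
    have "y = y [^] (i * m + int p * n)" using y mn by simp
    also have "\<dots> = y [^] (i * m)"
      using y int_pow_eq_one_of_dvd[OF y ex[OF y], of "int p * n"] by (simp add: int_pow_mult)
    also have "\<dots> = (y [^] i) [^] m" using y by (simp add: int_pow_pow)
    also have "y [^] i = inv h \<otimes> x" using h Hc y by (simp add: m_assoc[symmetric])
    also have "(inv h \<otimes> x) [^] m = inv h [^] m \<otimes> x [^] m"
      using h Hc x by (intro int_pow_mult_distrib) (auto simp: m_comm)
    finally have "y = inv h [^] m \<otimes> x [^] m" .
    moreover have "inv h [^] m \<in> H"
      using subgroup_int_pow_closed[OF H(1)] h(1) H(1) by (simp add: subgroup.m_inv_closed)
    ultimately show ?thesis by blast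
  qed
  have unique: "int p dvd m - n" if "x [^] m \<otimes> inv (x [^] n) \<in> H" for m n :: int
  proof (rule ccontr)
    assume "\<not> int p dvd m - n"
    then obtain k l where kl: "(m - n) * k + int p * l = 1" using bezout_prime[OF p] by blast
    have "x = x [^] ((m - n) * k + int p * l)" using x kl by simp
    also have "\<dots> = x [^] ((m - n) * k)"
      using x int_pow_eq_one_of_dvd[OF x(1) ex[OF x(1)], of "int p * l"] by (simp add: int_pow_mult)
    also have "\<dots> = (x [^] (m - n)) [^] k" using x by (simp add: int_pow_pow)
    also have "\<dots> \<in> H"
      using that x subgroup_int_pow_closed[OF H(1)] by (simp add: int_pow_diff)
    finally show False using H(2) by blast
  qed
  \<comment> \<open>\<open>e y\<close> is an arbitrary integer exponent; only its residue modulo p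
    is determined, as \<open>e_unique\<close> records.\<close>
  define e where "e y = (SOME m::int. \<exists>h\<in>H. y = h \<otimes> x [^] m)" for y
  have e: "\<exists>h\<in>H. y = h \<otimes> x [^] e y" if "y \<in> carrier G" for y
    unfolding e_def by (rule someI_ex) (rule span[OF that])
  have e_unique: "int p dvd e y - m" if "h \<in> H" "y = h \<otimes> x [^] m" for y h and m :: int
  proof -
    have "y \<in> carrier G" using that Hc x by simp
    then obtain h' where h': "h' \<in> H" "y = h' \<otimes> x [^] e y" using e by blast
    then have "x [^] e y = inv h' \<otimes> y"
      using \<open>y \<in> carrier G\<close> Hc x by (metis int_pow_closed inv_solve_left)
    then have "x [^] e y \<otimes> inv (x [^] m) = inv h' \<otimes> h"
      using that Hc h'(1) x by (simp add: m_assoc)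
    then show ?thesis using unique H(1) h'(1) that(1) by (simp add: subgroup.m_closed subgroup.m_inv_closed)
  qed
  have p0: "int p > 1" using p prime_gt_1_nat by simp
  show thesis
  proof
    show "e y mod int p \<in> {0..<int p}" for y using p0 by simp
    fix y z assume yz: "y \<in> carrier G" "z \<in> carrier G"
    then obtain h k where hk: "h \<in> H" "y = h \<otimes> x [^] e y" "k \<in> H" "z = k \<otimes> x [^] e z" using e by meson
    have "y \<otimes> z = (h \<otimes> x [^] e y) \<otimes> (k \<otimes> x [^] e z)" using hk by simp
    also have "\<dots> = (h \<otimes> k) \<otimes> x [^] (e y + e z)"
      using hk(1,3) Hc x by (simp add: int_pow_mult m_ac)
    finally have "int p dvd e (y \<otimes> z) - (e y + e z)"
      using e_unique hk(1,3) H(1) by (simp add: subgroup.m_closed)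
    then show "int p dvd e (y \<otimes> z) mod int p - (e y mod int p + e z mod int p)"
      by (simp add: mod_eq_dvd_iff[symmetric] mod_simps)
  next
    have "int p dvd e x - 1"
      using e_unique[OF subgroup.one_closed[OF H(1)], of x 1] x by simp
    then show "e x mod int p \<noteq> 0" using p0
      by (metis mod_eq_dvd_iff mod_pos_pos_trivial zero_le_one zero_neq_one)
  qed
qed

lemma (in group) subgroup_set_mult:
  assumes "subgroup K G" "subgroup J G" "\<And>j k. j \<in> J \<Longrightarrow> k \<in> K \<Longrightarrow> j \<otimes> k \<otimes> inv j \<in> K"
  shows "subgroup (K <#> J) G"
proof (rule subgroupI)
  note K = subgroup.mem_carrier[OF assms(1)] note J = subgroup.mem_carrier[OF assms(2)]
  show "K <#> J \<subseteq> carrier G" using K J by (auto simp: set_mult_def)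
  show "K <#> J \<noteq> {}" using assms(1,2)[THEN subgroup.one_closed] by (auto simp: set_mult_def)
  fix a assume "a \<in> K <#> J"
  then obtain k j where a: "a = k \<otimes> j" "k \<in> K" "j \<in> J" by (auto simp: set_mult_def)
  have "inv j \<otimes> inv k \<otimes> inv (inv j) \<in> K"
    using assms a by (simp add: subgroup.m_inv_closed)
  moreover have "inv a = (inv j \<otimes> inv k \<otimes> inv (inv j)) \<otimes> inv j"
    using a K J by (simp add: inv_mult_group m_assoc)
  ultimately show "inv a \<in> K <#> J"
    using a(3) assms(2) subgroup.m_inv_closed by (fastforce simp: set_mult_def)
  fix b assume "b \<in> K <#> J"
  then obtain k' j' where b: "b = k' \<otimes> j'" "k' \<in> K" "j' \<in> J" by (auto simp: set_mult_def)
  have "k \<otimes> (j \<otimes> k' \<otimes> inv j) \<in> K" "j \<otimes> j' \<in> J"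
    using assms a b by (simp_all add: subgroup.m_closed)
  moreover have "a \<otimes> b = (k \<otimes> (j \<otimes> k' \<otimes> inv j)) \<otimes> (j \<otimes> j')"
    using a b K J by (simp add: m_assoc) (simp add: m_assoc[symmetric])
  ultimately show "a \<otimes> b \<in> K <#> J" by (auto simp: set_mult_def)
qed

context profinite begin

text \<open>An element outside the closed subgroup W stays outside W U for a small open subgroup U,
  and V/W(U \<inter> V) is elementary abelian.\<close>
lemma ex_continuous_functional_nonzero:
  assumes p: "Factorial_Ring.prime p"
    and V: "subgroup V G" and W: "subgroup W G" "closedin T W" "W \<subseteq> V"
    and pw: "\<And>v. v \<in> V \<Longrightarrow> v [^] p \<in> W"
    and cm: "\<And>v w. v \<in> V \<Longrightarrow> w \<in> V \<Longrightarrow> comm G v w \<in> W"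
    and x: "x \<in> V" "x \<notin> W"
  obtains U \<theta> where "subgroup U G" "openin T U"
    "\<And>v. v \<in> V \<Longrightarrow> \<theta> v \<in> {0..<int p}"
    "\<And>v w. v \<in> V \<Longrightarrow> w \<in> V \<Longrightarrow> int p dvd \<theta> (v \<otimes> w) - (\<theta> v + \<theta> w)"
    "\<And>w. w \<in> W \<Longrightarrow> \<theta> w = 0" "\<And>u. u \<in> U \<Longrightarrow> u \<in> V \<Longrightarrow> \<theta> u = 0" "\<theta> x \<noteq> 0"
proof -
  note Vc = subgroup.mem_carrier[OF V]
  \<comment> \<open>The complement of W, translated by x, is a neighbourhood of 1; a subgroup U
    inside it has x U disjoint from W.\<close>
  have Oo: "openin T {y \<in> topspace T. x \<otimes> y \<in> topspace T - W}"
    by (rule openin_continuous_map_preimage[OF continuous_map_lmult])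
      (use x Vc W(2) in \<open>auto simp: closedin_def\<close>)
  obtain U where U: "subgroup U G" "openin T U" "U \<subseteq> {y \<in> topspace T. x \<otimes> y \<in> topspace T - W}"
    by (rule open_subgroup_in_nbhd[OF Oo]) (use x Vc in auto)
  \<comment> \<open>As \<open>comm\<close> is g^-1 h^-1 g h, inserting inverses gives comm(v^-1,
    w^-1) w = v w v^-1. So V normalises every subgroup between W and V; this serves for W and for
    H.\<close>
  have normW: "v \<otimes> w \<otimes> inv v \<in> K" if "subgroup K G" "W \<subseteq> K" "K \<subseteq> V" "v \<in> V" "w \<in> K" for v w K
  proof -
    have "comm G (inv v) (inv w) \<otimes> w \<in> K"
      using that cm V by (meson subgroup.m_closed subgroup.m_inv_closed subsetD)
    then show ?thesis using that Vc by (simp add: comm_def m_assoc subset_iff)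
  qed
  define H where "H = W <#> (U \<inter> V)"
  have sUV: "subgroup (U \<inter> V) G" using U(1) V subgroups_Inter_pair by blast
  have sH: "subgroup H G"
    unfolding H_def using W V U by (intro subgroup_set_mult) (auto intro!: sUV normW)
  have HV: "H \<subseteq> V" using W(3) V by (auto simp: H_def set_mult_def subgroup.m_closed)
  have WH: "w \<in> H" if "w \<in> W" for w
  proof -
    have "w \<otimes> \<one> \<in> H" unfolding H_def set_mult_def using that subgroup.one_closed[OF sUV] by blast
    then show ?thesis using subgroup.mem_carrier[OF W(1) that] by simp
  qed
  have UH: "u \<in> H" if "u \<in> U" "u \<in> V" for u
  proof -
    have "\<one> \<otimes> u \<in> H" unfolding H_def set_mult_def using that subgroup.one_closed[OF W(1)] by blast
    then show ?thesis using Vc that by simp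
  qed
  have xH: "x \<notin> H"
  proof
    assume "x \<in> H"
    then obtain w u where wu: "w \<in> W" "u \<in> U" "u \<in> V" "x = w \<otimes> u" by (auto simp: H_def set_mult_def)
    then have "x \<otimes> inv u = w" using Vc W(3) by (simp add: m_assoc subset_iff)
    moreover have "inv u \<in> U" using wu U(1) by (simp add: subgroup.m_inv_closed)
    ultimately show False using U(3) wu(1) by auto
  qed
  \<comment> \<open>The quotient by H is taken inside V, where H is normal, so V becomes a group of
    its own and its inverses and powers are matched with those of G.\<close>
  define GV where "GV = G\<lparr>carrier := V\<rparr>"
  interpret GV: group GV unfolding GV_def by (rule subgroup_imp_group[OF V])
  have [simp]: "carrier GV = V" "monoid.mult GV = monoid.mult G" "one GV = one G" by (simp_all add: GV_def)
  have invGV: "inv\<^bsub>GV\<^esub> v = inv v" if "v \<in> V" for v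
    unfolding GV_def by (rule m_inv_consistent[OF V that])
  have powGV: "v [^]\<^bsub>GV\<^esub> (n::nat) = v [^] n" for v n unfolding GV_def by (simp add: nat_pow_def)
  have sHV: "subgroup H GV"
    using sH HV V unfolding GV_def by (simp add: subgroup_incl)
  interpret nH: normal H GV
  proof (rule GV.normal_invI[OF sHV])
    fix v h assume "v \<in> carrier GV" "h \<in> H"
    then show "v \<otimes>\<^bsub>GV\<^esub> h \<otimes>\<^bsub>GV\<^esub> inv\<^bsub>GV\<^esub> v \<in> H"
      using normW[OF sH _ HV] WH by (simp add: invGV subset_iff)
  qed
  let ?B = "GV Mod H"
  have coset_one: "H #>\<^bsub>GV\<^esub> v = \<one>\<^bsub>?B\<^esub> \<longleftrightarrow> v \<in> H" if "v \<in> V" for v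
    using that GV.coset_join1[OF _ _ sHV] GV.coset_join2[OF _ sHV] by (auto simp: FactGroup_def)
  have coset_mult: "(H #>\<^bsub>GV\<^esub> v) \<otimes>\<^bsub>?B\<^esub> (H #>\<^bsub>GV\<^esub> w) = H #>\<^bsub>GV\<^esub> (v \<otimes> w)" if "v \<in> V" "w \<in> V" for v w
    using that nH.rcos_sum by (simp add: FactGroup_def)
  have coset_carrier: "H #>\<^bsub>GV\<^esub> v \<in> carrier ?B" if "v \<in> V" for v
    using that by (auto simp: FactGroup_def RCOSETS_def)
  have carrierB: "\<exists>v\<in>V. c = H #>\<^bsub>GV\<^esub> v" if "c \<in> carrier ?B" for c
    using that by (auto simp: FactGroup_def RCOSETS_def)
  interpret B: group ?B by (rule nH.factorgroup_is_group)
  interpret B: comm_group ?B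
  proof (rule B.group_comm_groupI)
    fix a b assume "a \<in> carrier ?B" "b \<in> carrier ?B"
    then obtain v w where vw: "v \<in> V" "a = H #>\<^bsub>GV\<^esub> v" "w \<in> V" "b = H #>\<^bsub>GV\<^esub> w" using carrierB by metis
    have "comm G (inv v) (inv w) \<in> H" using WH cm vw V by (simp add: subgroup.m_inv_closed)
    moreover have "comm G (inv v) (inv w) \<otimes> (w \<otimes> v) = v \<otimes> w"
      using vw Vc by (simp add: comm_def m_assoc) (simp add: m_assoc[symmetric])
    ultimately have "v \<otimes> w \<in> H #>\<^bsub>GV\<^esub> (w \<otimes> v)" unfolding r_coset_def by force
    then have "H #>\<^bsub>GV\<^esub> (w \<otimes> v) = H #>\<^bsub>GV\<^esub> (v \<otimes> w)"
      using vw V by (intro GV.repr_independence) (auto simp: subgroup.m_closed sHV)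
    then show "a \<otimes>\<^bsub>?B\<^esub> b = b \<otimes>\<^bsub>?B\<^esub> a" using vw coset_mult by simp
  qed
  have coset_pow: "(H #>\<^bsub>GV\<^esub> v) [^]\<^bsub>?B\<^esub> (n::nat) = H #>\<^bsub>GV\<^esub> (v [^] n)" if v: "v \<in> V" for v n
    using nH.FactGroup_pow[of v n] v by (simp add: powGV)
  have powB: "y [^]\<^bsub>?B\<^esub> p = \<one>\<^bsub>?B\<^esub>" if "y \<in> carrier ?B" for y
  proof -
    obtain v where v: "v \<in> V" "y = H #>\<^bsub>GV\<^esub> v" using carrierB \<open>y \<in> carrier ?B\<close> by blast
    then show ?thesis
      using coset_pow[OF v(1)] coset_one pw[OF v(1)] WH W(3) by (simp add: subset_iff)
  qed
  have xB: "H #>\<^bsub>GV\<^esub> x \<noteq> \<one>\<^bsub>?B\<^esub>" using coset_one x xH by auto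
  obtain \<theta> where \<theta>: "\<And>y. y \<in> carrier ?B \<Longrightarrow> \<theta> y \<in> {0..<int p}"
    "\<And>y z. y \<in> carrier ?B \<Longrightarrow> z \<in> carrier ?B \<Longrightarrow> int p dvd \<theta> (y \<otimes>\<^bsub>?B\<^esub> z) - (\<theta> y + \<theta> z)"
    "\<theta> (H #>\<^bsub>GV\<^esub> x) \<noteq> 0"
    using B.ex_functional_nonzero[OF p powB coset_carrier[OF x(1)] xB] by blast
  have one0: "\<theta> \<one>\<^bsub>?B\<^esub> = 0"
  proof -
    have "int p dvd \<theta> \<one>\<^bsub>?B\<^esub>" using \<theta>(2)[OF B.one_closed B.one_closed] unfolding B.l_one[OF B.one_closed] by simp
    then have "\<theta> \<one>\<^bsub>?B\<^esub> mod int p = 0" by (rule dvd_imp_mod_0)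
    moreover have "\<theta> \<one>\<^bsub>?B\<^esub> mod int p = \<theta> \<one>\<^bsub>?B\<^esub>"
      using \<theta>(1)[OF B.one_closed] by (intro mod_pos_pos_trivial) auto
    ultimately show ?thesis by (rule trans[OF sym, rotated])
  qed
  show thesis
  proof (rule that[OF U(1,2), of "\<lambda>v. \<theta> (H #>\<^bsub>GV\<^esub> v)"])
    show "int p dvd \<theta> (H #>\<^bsub>GV\<^esub> (v \<otimes> w)) - (\<theta> (H #>\<^bsub>GV\<^esub> v) + \<theta> (H #>\<^bsub>GV\<^esub> w))"
      if "v \<in> V" "w \<in> V" for v w
      using \<theta>(2)[OF coset_carrier coset_carrier] that coset_mult by simp
    show "\<theta> (H #>\<^bsub>GV\<^esub> w) = 0" if "w \<in> W" for w
      using coset_one[of w] WH W(3) one0 that by auto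
    show "\<theta> (H #>\<^bsub>GV\<^esub> u) = 0" if "u \<in> U" "u \<in> V" for u
      using coset_one[of u] UH one0 that by auto
  qed (use \<theta> coset_carrier in auto)
qed

end

section \<open>Continuous cochains modulo p\<close>

lemma dvd_mod_cancel: "(k::int) dvd a mod k - b \<longleftrightarrow> k dvd a - b" "k dvd b - a mod k \<longleftrightarrow> k dvd b - a"
  "k dvd a mod k + b \<longleftrightarrow> k dvd a + b"
  using mod_eq_dvd_iff[of "a mod k" k b] mod_eq_dvd_iff[of a k b]
    mod_eq_dvd_iff[of b k "a mod k"] mod_eq_dvd_iff[of b k a]
    mod_eq_dvd_iff[of "a mod k" k "-b"] mod_eq_dvd_iff[of a k "-b"] by simp_all

text \<open>The signs are those of the 2-cocycle identity: reduced values may be replaced by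
  unreduced ones before identities are added.\<close>

lemma dvd_mod_four:
  "(k::int) dvd a mod k - b mod k + c mod k - d mod k \<longleftrightarrow> k dvd a - b + c - d"
proof -
  have "a - b + c - d = k * (a div k - b div k + c div k - d div k) + (a mod k - b mod k + c mod k - d mod k)"
    by (simp add: algebra_simps minus_mult_div_eq_mod[symmetric])
  then show ?thesis using dvd_add_right_iff[OF dvd_triv_left] by metis
qed

text \<open>The signs are those of a coboundary. Together with \<open>add_mod_three\<close> this
  makes the coboundary map compatible with negation and addition of reduced cochains, so that
  \<open>B2\<close> is a subgroup.\<close>

lemma uminus_mod_three:
  "(- ((a - b + d) mod k)) mod k = ((- a) mod k - (- b) mod k + (- d) mod k) mod (k::int)"
proof -
  have "- ((a - b + d) mod k) - ((- a) mod k - (- b) mod k + (- d) mod k) =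
      k * ((a - b + d) div k + (- a) div k - (- b) div k + (- d) div k)"
    by (simp add: algebra_simps minus_mult_div_eq_mod[symmetric])
  then show ?thesis by (simp only: mod_eq_dvd_iff dvd_triv_left)
qed

lemma add_mod_three:
  "((a - b + d) mod k + (a' - b' + d') mod k) mod k =
     ((a + a') mod k - (b + b') mod k + (d + d') mod k) mod (k::int)"
proof -
  have "(a - b + d) mod k + (a' - b' + d') mod k - ((a + a') mod k - (b + b') mod k + (d + d') mod k) =
      k * ((a + a') div k - (b + b') div k + (d + d') div k - (a - b + d) div k - (a' - b' + d') div k)"
    by (simp add: algebra_simps minus_mult_div_eq_mod[symmetric])
  then show ?thesis by (simp only: mod_eq_dvd_iff dvd_triv_left)
qed

lemma eq_of_dvd_diff: "(k::int) dvd a - b \<Longrightarrow> a \<in> {0..<k} \<Longrightarrow> b \<in> {0..<k} \<Longrightarrow> a = b"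
  by (metis atLeastLessThan_iff mod_eq_dvd_iff mod_pos_pos_trivial)

lemma eq_mod_of_dvd: "(k::int) dvd a - b \<Longrightarrow> a \<in> {0..<k} \<Longrightarrow> a = b mod k"
  by (metis atLeastLessThan_iff mod_eq_dvd_iff mod_pos_pos_trivial)

abbreviation cont_fun :: "'a topology \<Rightarrow> nat \<Rightarrow> ('a \<Rightarrow> int) \<Rightarrow> bool" where
  "cont_fun T p \<equiv> continuous_map T (discrete_topology {0..<int p})"

section \<open>Cocycles, coboundaries and the group H^2\<close>

locale cochains = top_group +
  fixes p :: nat
  assumes prime_p: "Factorial_Ring.prime p"
begin

lemma p_pos: "int p > 0"
  using prime_gt_0_nat[OF prime_p] by simp

lemma cont_fun_range: "cont_fun T p c \<Longrightarrow> x \<in> carrier G \<Longrightarrow> c x \<in> {0..<int p}"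
  by (rule continuous_map_discrete_range) auto

lemma cont_fun_mod1: "cont_fun T p c \<Longrightarrow> cont_fun T p (\<lambda>x. F (c x) mod int p)"
  using p_pos by (intro continuous_map_discrete_comp1[where F = "\<lambda>a. F a mod int p"]) auto

lemma cont_fun_mod2: "cont_fun T p c \<Longrightarrow> cont_fun T p d \<Longrightarrow> cont_fun T p (\<lambda>x. F (c x) (d x) mod int p)"
  using p_pos by (intro continuous_map_discrete_comp2[where F = "\<lambda>a b. F a b mod int p"]) auto

lemma Z2_range: "f \<in> Z2 G T p \<Longrightarrow> x \<in> carrier G \<Longrightarrow> y \<in> carrier G \<Longrightarrow> f x y \<in> {0..<int p}"
  using continuous_map_discrete_range[of "prod_topology T T" "{0..<int p}" "\<lambda>(x, y). f x y" "(x, y)"]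
  by (simp add: Z2_def)

lemma Z2_outside: "f \<in> Z2 G T p \<Longrightarrow> x \<notin> carrier G \<or> y \<notin> carrier G \<Longrightarrow> f x y = 0"
  by (simp add: Z2_def)

lemma Z2_mod: "f \<in> Z2 G T p \<Longrightarrow> f x y mod int p = f x y"
  using Z2_range[of f x y] Z2_outside[of f x y] by (cases "x \<in> carrier G \<and> y \<in> carrier G") auto

lemma Z2_cocycle:
  "f \<in> Z2 G T p \<Longrightarrow> g \<in> carrier G \<Longrightarrow> h \<in> carrier G \<Longrightarrow> k \<in> carrier G \<Longrightarrow>
     int p dvd f h k - f (g \<otimes> h) k + f g (h \<otimes> k) - f g h"
  by (simp add: Z2_def dvd_eq_mod_eq_0)

lemma Z2_cont: "f \<in> Z2 G T p \<Longrightarrow> continuous_map (prod_topology T T) (discrete_topology {0..<int p}) (\<lambda>(x, y). f x y)"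
  by (simp add: Z2_def)

lemma Z2I:
  assumes "continuous_map (prod_topology T T) (discrete_topology {0..<int p}) (\<lambda>(x, y). f x y)"
    and "\<And>x y. x \<notin> carrier G \<or> y \<notin> carrier G \<Longrightarrow> f x y = 0"
    and "\<And>g h k. g \<in> carrier G \<Longrightarrow> h \<in> carrier G \<Longrightarrow> k \<in> carrier G \<Longrightarrow>
     int p dvd f h k - f (g \<otimes> h) k + f g (h \<otimes> k) - f g h"
  shows "f \<in> Z2 G T p"
  using assms by (simp add: Z2_def dvd_eq_mod_eq_0)

lemma Z2_zero: "(\<lambda>x y. 0) \<in> Z2 G T p"
proof (rule Z2I)
  have "(\<lambda>(x, y). 0) = (\<lambda>z :: 'a \<times> 'a. 0 :: int)" by auto
  then show "cont_fun (prod_topology T T) p (\<lambda>(x, y). 0)" using p_pos by simp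
qed auto

lemma Z2_add:
  assumes f: "f \<in> Z2 G T p" and g: "g \<in> Z2 G T p"
  shows "(\<lambda>x y. (f x y + g x y) mod int p) \<in> Z2 G T p"
proof (rule Z2I)
  show "continuous_map (prod_topology T T) (discrete_topology {0..<int p}) (\<lambda>(x, y). (f x y + g x y) mod int p)"
    by (rule continuous_map_discrete_eq[OF continuous_map_discrete_comp2[OF Z2_cont[OF f] Z2_cont[OF g],
            where F = "\<lambda>a b. (a + b) mod int p"]]) (use p_pos in auto)
  show "(f x y + g x y) mod int p = 0" if "x \<notin> carrier G \<or> y \<notin> carrier G" for x y
    using Z2_outside[OF f that] Z2_outside[OF g that] by simp
  fix a b c assume "a \<in> carrier G" "b \<in> carrier G" "c \<in> carrier G"
  then have "int p dvd f b c - f (a \<otimes> b) c + f a (b \<otimes> c) - f a b"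
    "int p dvd g b c - g (a \<otimes> b) c + g a (b \<otimes> c) - g a b" using Z2_cocycle f g by auto
  from dvd_add[OF this] show "int p dvd (f b c + g b c) mod int p - (f (a \<otimes> b) c + g (a \<otimes> b) c) mod int p
         + (f a (b \<otimes> c) + g a (b \<otimes> c)) mod int p - (f a b + g a b) mod int p"
    unfolding dvd_mod_four by (simp add: algebra_simps)
qed

lemma Z2_uminus:
  assumes f: "f \<in> Z2 G T p"
  shows "(\<lambda>x y. (- f x y) mod int p) \<in> Z2 G T p"
proof (rule Z2I)
  show "continuous_map (prod_topology T T) (discrete_topology {0..<int p}) (\<lambda>(x, y). (- f x y) mod int p)"
    by (rule continuous_map_discrete_eq[OF continuous_map_discrete_comp1[OF Z2_cont[OF f],
            where F = "\<lambda>a. (- a) mod int p"]]) (use p_pos in auto)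
  show "(- f x y) mod int p = 0" if "x \<notin> carrier G \<or> y \<notin> carrier G" for x y
    using Z2_outside[OF f that] by simp
  fix a b c assume "a \<in> carrier G" "b \<in> carrier G" "c \<in> carrier G"
  then have "int p dvd f b c - f (a \<otimes> b) c + f a (b \<otimes> c) - f a b" using Z2_cocycle f by auto
  moreover have "- f b c - - f (a \<otimes> b) c + - f a (b \<otimes> c) - - f a b = - (f b c - f (a \<otimes> b) c + f a (b \<otimes> c) - f a b)"
    by simp
  ultimately show "int p dvd (- f b c) mod int p - (- f (a \<otimes> b) c) mod int p
         + (- f a (b \<otimes> c)) mod int p - (- f a b) mod int p"
    unfolding dvd_mod_four by (simp only: dvd_minus_iff)
qed

lemma Z2_cobdry:
  assumes c: "cont_fun T p c"
  shows "cobdry G p c \<in> Z2 G T p"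
proof (rule Z2I)
  have 1: "continuous_map (prod_topology T T) (discrete_topology {0..<int p}) (\<lambda>z. c (fst z))"
    and 2: "continuous_map (prod_topology T T) (discrete_topology {0..<int p}) (\<lambda>z. c (snd z))"
    and 3: "continuous_map (prod_topology T T) (discrete_topology {0..<int p}) (\<lambda>z. c (fst z \<otimes> snd z))"
    using continuous_map_compose[OF continuous_map_fst c] continuous_map_compose[OF continuous_map_snd c]
      continuous_map_compose[OF continuous_map_mult c] by (simp_all add: o_def case_prod_beta)
  have 4: "continuous_map (prod_topology T T) (discrete_topology UNIV) (\<lambda>z. c (snd z) - c (fst z \<otimes> snd z))"
    by (rule continuous_map_discrete_comp2[OF 2 3, where F = "\<lambda>a b. a - b"]) simp
  show "continuous_map (prod_topology T T) (discrete_topology {0..<int p}) (\<lambda>(x, y). cobdry G p c x y)"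
    by (rule continuous_map_discrete_eq[OF continuous_map_discrete_comp2[OF 4 1, where F = "\<lambda>a b. (a + b) mod int p"]])
      (use p_pos in \<open>auto simp: cobdry_def\<close>)
  show "cobdry G p c x y = 0" if "x \<notin> carrier G \<or> y \<notin> carrier G" for x y
    using that by (auto simp: cobdry_def)
  fix a b d assume "a \<in> carrier G" "b \<in> carrier G" "d \<in> carrier G"
  then show "int p dvd cobdry G p c b d - cobdry G p c (a \<otimes> b) d + cobdry G p c a (b \<otimes> d) - cobdry G p c a b"
    by (simp add: cobdry_def dvd_mod_four m_assoc)
qed

lemma cobdry_eq:
  "x \<in> carrier G \<Longrightarrow> y \<in> carrier G \<Longrightarrow> cobdry G p c x y = (c x + c y - c (x \<otimes> y)) mod int p"
  by (simp add: cobdry_def add.commute add_diff_eq)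

lemma eq_cobdry_iff:
  assumes f: "f \<in> Z2 G T p"
  shows "f = cobdry G p c \<longleftrightarrow> (\<forall>x\<in>carrier G. \<forall>y\<in>carrier G. int p dvd f x y - (c x + c y - c (x \<otimes> y)))"
proof -
  have "f x y = cobdry G p c x y \<longleftrightarrow> int p dvd f x y - (c x + c y - c (x \<otimes> y))"
    if "x \<in> carrier G" "y \<in> carrier G" for x y
    using that Z2_mod[OF f, of x y] by (metis cobdry_eq mod_eq_dvd_iff)
  moreover have "f x y = cobdry G p c x y" if "\<not> (x \<in> carrier G \<and> y \<in> carrier G)" for x y
    using that Z2_outside[OF f, of x y] by (auto simp: cobdry_def)
  ultimately show ?thesis unfolding fun_eq_iff by metis
qed

lemma Z2grp_simps [simp]: "carrier (Z2grp G T p) = Z2 G T p"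
  "f \<otimes>\<^bsub>Z2grp G T p\<^esub> g = (\<lambda>x y. (f x y + g x y) mod int p)" "\<one>\<^bsub>Z2grp G T p\<^esub> = (\<lambda>x y. 0)"
  by (simp_all add: Z2grp_def)

lemma comm_group_Z2grp: "comm_group (Z2grp G T p)"
proof (rule comm_groupI)
  fix f assume f: "f \<in> carrier (Z2grp G T p)"
  show "\<exists>g\<in>carrier (Z2grp G T p). g \<otimes>\<^bsub>Z2grp G T p\<^esub> f = \<one>\<^bsub>Z2grp G T p\<^esub>"
    using f by (intro bexI[of _ "\<lambda>x y. (- f x y) mod int p"]) (auto simp: Z2_uminus mod_simps)
qed (auto simp: Z2_add Z2_zero Z2_mod mod_simps add_ac)

sublocale Z: comm_group "Z2grp G T p" by (rule comm_group_Z2grp)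

lemma Z2_inv:
  assumes "f \<in> Z2 G T p" shows "inv\<^bsub>Z2grp G T p\<^esub> f = (\<lambda>x y. (- f x y) mod int p)"
  by (rule Z.inv_equality) (use assms in \<open>auto simp: Z2_uminus mod_simps\<close>)

lemma subgroup_B2: "subgroup (B2 G T p) (Z2grp G T p)"
proof (rule Z.subgroupI)
  show "B2 G T p \<subseteq> carrier (Z2grp G T p)" using Z2_cobdry by (auto simp: B2_def)
  have "cobdry G p (\<lambda>x. 0) \<in> B2 G T p" using p_pos by (auto simp: B2_def)
  then show "B2 G T p \<noteq> {}" by blast
  fix f assume "f \<in> B2 G T p"
  then obtain c where c: "f = cobdry G p c" "cont_fun T p c" by (auto simp: B2_def)
  have "inv\<^bsub>Z2grp G T p\<^esub> f = cobdry G p (\<lambda>x. (- c x) mod int p)"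
    unfolding c(1) Z2_inv[OF Z2_cobdry[OF c(2)]] by (auto simp: cobdry_def fun_eq_iff uminus_mod_three simp del: mod_minus_minus)
  then show "inv\<^bsub>Z2grp G T p\<^esub> f \<in> B2 G T p"
    using cont_fun_mod1[OF c(2), of uminus] by (auto simp: B2_def)
  fix g assume "g \<in> B2 G T p"
  then obtain d where d: "g = cobdry G p d" "cont_fun T p d" by (auto simp: B2_def)
  have "f \<otimes>\<^bsub>Z2grp G T p\<^esub> g = cobdry G p (\<lambda>x. (c x + d x) mod int p)"
    unfolding c(1) d(1) by (auto simp: cobdry_def fun_eq_iff add_mod_three)
  then show "f \<otimes>\<^bsub>Z2grp G T p\<^esub> g \<in> B2 G T p"
    using cont_fun_mod2[OF c(2) d(2), of "(+)"] by (auto simp: B2_def)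
qed

lemma normal_B2: "B2 G T p \<lhd> Z2grp G T p"
  by (rule Z.subgroup_imp_normal[OF subgroup_B2])

sublocale B: normal "B2 G T p" "Z2grp G T p" by (rule normal_B2)

sublocale H: group "H2 G T p"
  unfolding H2_def by (rule B.factorgroup_is_group)

lemma carrier_H2: "carrier (H2 G T p) = cls G T p ` Z2 G T p"
  by (auto simp: H2_def FactGroup_def RCOSETS_def cls_def)

lemma one_H2: "\<one>\<^bsub>H2 G T p\<^esub> = B2 G T p"
  by (simp add: H2_def FactGroup_def)

lemma cls_mult:
  assumes "f \<in> Z2 G T p" "g \<in> Z2 G T p"
  shows "cls G T p f \<otimes>\<^bsub>H2 G T p\<^esub> cls G T p g = cls G T p (\<lambda>x y. (f x y + g x y) mod int p)"
  using B.rcos_sum[of f g] assms by (simp add: H2_def FactGroup_def cls_def)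

lemma mem_B2_iff:
  assumes f: "f \<in> Z2 G T p"
  shows "f \<in> B2 G T p \<longleftrightarrow> (\<exists>c. cont_fun T p c \<and> (\<forall>x\<in>carrier G. \<forall>y\<in>carrier G. int p dvd f x y - (c x + c y - c (x \<otimes> y))))"
  unfolding eq_cobdry_iff[OF f, symmetric] B2_def by auto

lemma cls_eq_one_iff:
  assumes f: "f \<in> Z2 G T p"
  shows "cls G T p f = \<one>\<^bsub>H2 G T p\<^esub> \<longleftrightarrow> f \<in> B2 G T p"
  unfolding cls_def one_H2
  using Z.coset_join1[OF _ _ subgroup_B2] Z.coset_join2[OF _ subgroup_B2] f by auto

text \<open>Unfolds the coset once and for all into a congruence up to a continuous coboundary.
  Cocycles are reduced and vanish off the carrier, so a congruence on the carrier determines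
  them.\<close>

lemma mem_cls_iff:
  assumes f: "f \<in> Z2 G T p"
  shows "g \<in> cls G T p f \<longleftrightarrow> g \<in> Z2 G T p \<and>
    (\<exists>c. cont_fun T p c \<and> (\<forall>x\<in>carrier G. \<forall>y\<in>carrier G. int p dvd g x y - f x y - (c x + c y - c (x \<otimes> y))))"
proof
  assume "g \<in> cls G T p f"
  then obtain b where "b \<in> B2 G T p" "g = (\<lambda>x y. (b x y + f x y) mod int p)"
    unfolding cls_def r_coset_def by auto
  then obtain c where c: "cont_fun T p c" and g: "g = (\<lambda>x y. (cobdry G p c x y + f x y) mod int p)"
    unfolding B2_def by auto
  have "int p dvd g x y - f x y - (c x + c y - c (x \<otimes> y))" if "x \<in> carrier G" "y \<in> carrier G" for x y
  proof -
    have "int p dvd ((c x + c y - c (x \<otimes> y)) mod int p + f x y) mod int p - (f x y + (c x + c y - c (x \<otimes> y)))"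
      by (simp add: mod_eq_dvd_iff[symmetric] mod_simps add.commute)
    then show ?thesis using that unfolding g by (simp add: cobdry_eq diff_diff_eq)
  qed
  then show "g \<in> Z2 G T p \<and>
    (\<exists>c. cont_fun T p c \<and> (\<forall>x\<in>carrier G. \<forall>y\<in>carrier G. int p dvd g x y - f x y - (c x + c y - c (x \<otimes> y))))"
    using Z2_add[OF Z2_cobdry[OF c] f] c g by blast
next
  assume R: "g \<in> Z2 G T p \<and>
    (\<exists>c. cont_fun T p c \<and> (\<forall>x\<in>carrier G. \<forall>y\<in>carrier G. int p dvd g x y - f x y - (c x + c y - c (x \<otimes> y))))"
  then obtain c where c: "cont_fun T p c" and
    d: "\<And>x y. x \<in> carrier G \<Longrightarrow> y \<in> carrier G \<Longrightarrow> int p dvd g x y - f x y - (c x + c y - c (x \<otimes> y))" by blast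
  have "g x y = (cobdry G p c x y + f x y) mod int p" for x y
  proof (cases "x \<in> carrier G \<and> y \<in> carrier G")
    case True
    then have "(g x y) mod int p = (c y - c (x \<otimes> y) + c x + f x y) mod int p"
      using d[of x y] by (simp add: mod_eq_dvd_iff algebra_simps)
    with True Z2_mod[of g x y] R show ?thesis by (simp add: cobdry_def mod_simps)
  next
    case False
    then show ?thesis using Z2_outside[of g x y] Z2_outside[of f x y] R f by (auto simp: cobdry_def)
  qed
  then have "g = (\<lambda>x y. (cobdry G p c x y + f x y) mod int p)" by blast
  moreover have "cobdry G p c \<in> B2 G T p" using c by (auto simp: B2_def)
  ultimately show "g \<in> cls G T p f" unfolding cls_def r_coset_def by auto
qed

lemma cls_self: "f \<in> Z2 G T p \<Longrightarrow> f \<in> cls G T p f"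
  unfolding cls_def using Z.rcos_self[OF _ subgroup_B2] by simp

lemma cls_eqI: "f \<in> Z2 G T p \<Longrightarrow> g \<in> cls G T p f \<Longrightarrow> cls G T p g = cls G T p f"
  unfolding cls_def using Z.repr_independence[OF _ _ subgroup_B2] by fastforce

lemma cls_inv:
  assumes f: "f \<in> Z2 G T p"
  shows "inv\<^bsub>H2 G T p\<^esub> cls G T p f = cls G T p (\<lambda>x y. (- f x y) mod int p)"
proof (rule H.inv_equality)
  show "cls G T p (\<lambda>x y. (- f x y) mod int p) \<otimes>\<^bsub>H2 G T p\<^esub> cls G T p f = \<one>\<^bsub>H2 G T p\<^esub>"
    using Z2_zero subgroup.one_closed[OF subgroup_B2]
    by (simp add: cls_mult Z2_uminus f mod_simps cls_eq_one_iff)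
qed (use f Z2_uminus in \<open>auto simp: carrier_H2\<close>)

end

section \<open>The transgression\<close>

text \<open>A function constant on the fibres factors through h, and the quotient topology makes the
  factor continuous. The value 0 off the space follows the convention for cochains.\<close>

lemma quotient_map_descend:
  fixes c :: "'a \<Rightarrow> int"
  assumes h: "quotient_map S R h" and c: "continuous_map S (discrete_topology D) c"
    and fib: "\<And>x y. x \<in> topspace S \<Longrightarrow> y \<in> topspace S \<Longrightarrow> h x = h y \<Longrightarrow> c x = c y"
  obtains d where "continuous_map R (discrete_topology D) d" "\<And>x. x \<in> topspace S \<Longrightarrow> d (h x) = c x"
    "\<And>y. y \<notin> topspace R \<Longrightarrow> d y = 0"
proof -
  define d where "d y = (if y \<in> topspace R then c (SOME x. x \<in> topspace S \<and> h x = y) else 0)" for y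
  have d: "d (h x) = c x" if "x \<in> topspace S" for x
  proof -
    have "h x \<in> topspace R" using quotient_imp_surjective_map[OF h] that by blast
    moreover have "(SOME x'. x' \<in> topspace S \<and> h x' = h x) \<in> topspace S \<and> h (SOME x'. x' \<in> topspace S \<and> h x' = h x) = h x"
      by (rule someI[of _ x]) (use that in simp)
    ultimately show ?thesis unfolding d_def using fib[OF _ that] by auto
  qed
  have "continuous_map R (discrete_topology D) d"
    by (rule continuous_compose_quotient_map[OF h], rule continuous_map_discrete_eq[OF c]) (simp add: d)
  from that[OF this d] show thesis by (simp add: d_def)
qed

text \<open>Such a map is closed. Hence Q, given only as a continuous image of G, carries the
  quotient topology, and cochains that are constant on fibres descend to it.\<close>

lemma quotient_map_compact_Hausdorff:
  assumes "compact_space S" "Hausdorff_space R" "continuous_map S R h" "h ` topspace S = topspace R"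
  shows "quotient_map S R h"
  using assms by (intro continuous_closed_imp_quotient_map continuous_imp_closed_map_gen Hausdorff_imp_kc_space)

section \<open>The lower p-central filtration\<close>

context cochains begin

lemma lpc_two: "lpc G T p 2 = closed_gen G T ({x [^] p | x. x \<in> carrier G}
    \<union> {comm G g h | g h. g \<in> carrier G \<and> h \<in> carrier G})"
  by (simp add: numeral_2_eq_2)

lemma lpc_three: "lpc G T p 3 = closed_gen G T ({x [^] p | x. x \<in> lpc G T p 2}
    \<union> {comm G g h | g h. g \<in> carrier G \<and> h \<in> lpc G T p 2})"
  by (simp add: numeral_3_eq_3 numeral_2_eq_2)

lemma comm_closed [simp]: "g \<in> carrier G \<Longrightarrow> h \<in> carrier G \<Longrightarrow> comm G g h \<in> carrier G"
  by (simp add: comm_def)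

lemma mult_comm: "g \<in> carrier G \<Longrightarrow> h \<in> carrier G \<Longrightarrow> (h \<otimes> g) \<otimes> comm G g h = g \<otimes> h"
  by (simp add: comm_def m_assoc) (simp add: m_assoc[symmetric])

lemma lpc_two_gens_closed: "{x [^] p | x. x \<in> carrier G} \<union> {comm G g h | g h. g \<in> carrier G \<and> h \<in> carrier G} \<subseteq> carrier G"
  by auto

lemma subgroup_lpc_two: "subgroup (lpc G T p 2) G"
  unfolding lpc_two by (rule subgroup_closed_gen[OF lpc_two_gens_closed])

lemma closedin_lpc_two: "closedin T (lpc G T p 2)"
  unfolding lpc_two by (rule closedin_closed_gen[OF lpc_two_gens_closed])

lemma lpc_two_carrier: "a \<in> lpc G T p 2 \<Longrightarrow> a \<in> carrier G"
  by (rule subgroup.mem_carrier[OF subgroup_lpc_two])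

lemma lpc_two_gens: "x \<in> carrier G \<Longrightarrow> x [^] p \<in> lpc G T p 2"
   "g \<in> carrier G \<Longrightarrow> h \<in> carrier G \<Longrightarrow> comm G g h \<in> lpc G T p 2"
  unfolding lpc_two by (rule subsetD[OF closed_gen_superset]; blast)+

lemma lpc_three_gens_closed: "{x [^] p | x. x \<in> lpc G T p 2} \<union> {comm G g h | g h. g \<in> carrier G \<and> h \<in> lpc G T p 2} \<subseteq> carrier G"
  using lpc_two_carrier by auto

lemma subgroup_lpc_three: "subgroup (lpc G T p 3) G"
  unfolding lpc_three by (rule subgroup_closed_gen[OF lpc_three_gens_closed])

lemma closedin_lpc_three: "closedin T (lpc G T p 3)"
  unfolding lpc_three by (rule closedin_closed_gen[OF lpc_three_gens_closed])

lemma lpc_three_gens: "x \<in> lpc G T p 2 \<Longrightarrow> x [^] p \<in> lpc G T p 3"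
   "g \<in> carrier G \<Longrightarrow> h \<in> lpc G T p 2 \<Longrightarrow> comm G g h \<in> lpc G T p 3"
  unfolding lpc_three by (rule subsetD[OF closed_gen_superset]; blast)+

lemma lpc_three_subset: "lpc G T p 3 \<subseteq> lpc G T p 2"
  unfolding lpc_three
  by (rule closed_gen_minimal[OF subgroup_lpc_two closedin_lpc_two]) (auto simp: lpc_two_gens lpc_two_carrier)

text \<open>The kernel of c modulo p is closed because c is locally constant, and it contains p-th
  powers and commutators because Z/p is abelian of exponent p. Values lie in {0..<p}, so
  divisibility by p becomes equality with 0.\<close>

lemma hom_vanishes_on_lpc_two:
  assumes c: "cont_fun T p c" and hom: "\<And>x y. x \<in> carrier G \<Longrightarrow> y \<in> carrier G \<Longrightarrow> int p dvd c (x \<otimes> y) - (c x + c y)"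
    and a: "a \<in> lpc G T p 2"
  shows "c a = 0"
proof -
  have c1: "int p dvd c \<one>" using hom[of \<one> \<one>] by simp
  have cinv: "int p dvd c (inv x) + c x" if x: "x \<in> carrier G" for x
    using dvd_diff[OF c1 hom[OF inv_closed[OF x] x]] x by simp
  have cpow: "int p dvd c (x [^] n) - int n * c x" if x: "x \<in> carrier G" for x and n :: nat
  proof (induction n)
    case (Suc n)
    then show ?case using dvd_add[OF Suc hom[of "x [^] n" x]] x by (simp add: algebra_simps)
  qed (use c1 in simp)
  have ccomm: "int p dvd c (comm G g h)" if gh: "g \<in> carrier G" "h \<in> carrier G" for g h
  proof -
    have "int p dvd c (g \<otimes> h) - (c (h \<otimes> g) + c (comm G g h))"
      using hom[of "h \<otimes> g" "comm G g h"] gh by (simp add: mult_comm)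
    from dvd_diff[OF dvd_diff[OF hom[OF gh] hom[OF gh(2,1)]] this]
    show ?thesis by (simp add: algebra_simps)
  qed
  define H where "H = {x \<in> topspace T. int p dvd c x}"
  have "lpc G T p 2 \<subseteq> H"
    unfolding lpc_two
  proof (rule closed_gen_minimal)
    show "subgroup H G"
    proof (rule subgroupI)
      show "H \<noteq> {}" using c1 by (auto simp: H_def)
      show "inv x \<in> H" if "x \<in> H" for x
        using that cinv[of x] by (simp add: H_def dvd_add_left_iff)
      show "x \<otimes> y \<in> H" if "x \<in> H" "y \<in> H" for x y
        using that hom[of x y] dvd_add[of "int p" "c (x \<otimes> y) - (c x + c y)" "c x + c y"] by (simp add: H_def)
    qed (auto simp: H_def)
    show "closedin T H" unfolding H_def by (rule closedin_discrete_vimage[OF c])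
    have "int p dvd c (x [^] p)" if "x \<in> carrier G" for x
      using dvd_add[OF cpow[OF that, of p], of "int p * c x"] by simp
    then show "{x [^] p | x. x \<in> carrier G} \<union> {comm G g h | g h. g \<in> carrier G \<and> h \<in> carrier G} \<subseteq> H"
      using ccomm by (auto simp: H_def)
  qed
  then have "int p dvd c a - 0" using a by (auto simp: H_def)
  then show ?thesis using eq_of_dvd_diff[of "int p" "c a" 0] cont_fun_range[OF c] a lpc_two_carrier p_pos by auto
qed

end

section \<open>Cochains on G whose coboundary is inflated from Q\<close>

locale frattini_quotient = cochains G T p + profinite G T + Q: cochains Q TQ p + Q: profinite Q TQ
  for G :: "('g, 'b) monoid_scheme" (structure) and T p and Q :: "('h, 'c) monoid_scheme" and TQ +
  fixes q :: "'g \<Rightarrow> 'h"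
  assumes q_hom: "q \<in> hom G Q" and q_cont: "continuous_map T TQ q"
    and q_surj: "q ` carrier G = carrier Q" and q_kernel: "kernel G Q q = lpc G T p 2"
begin

abbreviation "\<Phi> \<equiv> lpc G T p 2"

lemma q_closed [simp]: "x \<in> carrier G \<Longrightarrow> q x \<in> carrier Q"
  using q_surj by blast

lemma q_mult [simp]: "x \<in> carrier G \<Longrightarrow> y \<in> carrier G \<Longrightarrow> q (x \<otimes> y) = q x \<otimes>\<^bsub>Q\<^esub> q y"
  using q_hom by (simp add: hom_def)

lemma q_one [simp]: "q \<one> = \<one>\<^bsub>Q\<^esub>"
  using hom_one[OF q_hom is_group Q.is_group] .

lemma q_inv [simp]: "x \<in> carrier G \<Longrightarrow> q (inv x) = inv\<^bsub>Q\<^esub> q x"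
  using group_hom.hom_inv[of G Q q] q_hom by (simp add: group_hom_def group_hom_axioms_def)

lemma mem_Phi_iff: "a \<in> \<Phi> \<longleftrightarrow> a \<in> carrier G \<and> q a = \<one>\<^bsub>Q\<^esub>"
  unfolding q_kernel[symmetric] kernel_def by simp

lemma q_eqE:
  assumes "x \<in> carrier G" "y \<in> carrier G" "q x = q y"
  obtains a where "a \<in> \<Phi>" "y = a \<otimes> x"
proof (rule that)
  show "y \<otimes> inv x \<in> \<Phi>" using assms by (simp add: mem_Phi_iff)
  show "y = (y \<otimes> inv x) \<otimes> x" using assms by (simp add: m_assoc)
qed

lemma Phi_conj: "a \<in> \<Phi> \<Longrightarrow> g \<in> carrier G \<Longrightarrow> g \<otimes> a \<otimes> inv g \<in> \<Phi>"
  by (simp add: mem_Phi_iff)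

lemma quotient_map_q: "quotient_map T TQ q"
  using compact_space Q.Hausdorff_space q_cont q_surj by (intro quotient_map_compact_Hausdorff) auto

lemma quotient_map_qq: "quotient_map (prod_topology T T) (prod_topology TQ TQ) (\<lambda>z. (q (fst z), q (snd z)))"
proof (rule quotient_map_compact_Hausdorff)
  show "continuous_map (prod_topology T T) (prod_topology TQ TQ) (\<lambda>z. (q (fst z), q (snd z)))"
    using continuous_map_compose[OF continuous_map_fst[of T T] q_cont] continuous_map_compose[OF continuous_map_snd[of T T] q_cont]
    by (simp add: continuous_map_paired o_def)
  show "(\<lambda>z. (q (fst z), q (snd z))) ` topspace (prod_topology T T) = topspace (prod_topology TQ TQ)"
    using image_paired_Times[of q q "carrier G" "carrier G"] by (simp add: q_surj case_prod_beta')
qed (use compact_space Q.Hausdorff_space in \<open>simp_all add: compact_space_prod_topology Hausdorff_space_prod_topology\<close>)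

lemma cont_fun_descend:
  assumes "cont_fun T p c" "\<And>a x. a \<in> \<Phi> \<Longrightarrow> x \<in> carrier G \<Longrightarrow> c (a \<otimes> x) = c x"
  obtains d where "cont_fun TQ p d" "\<And>x. x \<in> carrier G \<Longrightarrow> d (q x) = c x" "\<And>u. u \<notin> carrier Q \<Longrightarrow> d u = 0"
proof (rule quotient_map_descend[OF quotient_map_q assms(1)])
  fix x y assume "x \<in> topspace T" "y \<in> topspace T" "q x = q y"
  then show "c x = c y" using assms(2) q_eqE[of x y] by (metis topspace_eq)
qed (use that in auto)

lemma cont_fun_q: "cont_fun TQ p d \<Longrightarrow> cont_fun T p (\<lambda>x. d (q x))"
  using continuous_map_compose[OF q_cont] by (simp add: o_def)

text \<open>The transgression is kept as a relation: c is a witness that the inflation of f is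
  trivial, and the functional belonging to f is c - c(1) on \<Phi>. That it depends only on the
  class of f is the content of \<open>compat_unique\<close> and \<open>compat_cls\<close>.\<close>

definition compat :: "('h \<Rightarrow> 'h \<Rightarrow> int) \<Rightarrow> ('g \<Rightarrow> int) \<Rightarrow> bool" where
  "compat f c \<longleftrightarrow> f \<in> Z2 Q TQ p \<and> cont_fun T p c \<and>
     (\<forall>x\<in>carrier G. \<forall>y\<in>carrier G. int p dvd f (q x) (q y) - (c x + c y - c (x \<otimes> y)))"

lemma compatD:
  assumes "compat f c"
  shows "f \<in> Z2 Q TQ p" "cont_fun T p c"
    "x \<in> carrier G \<Longrightarrow> y \<in> carrier G \<Longrightarrow> int p dvd f (q x) (q y) - (c x + c y - c (x \<otimes> y))"
  using assms by (auto simp: compat_def)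

text \<open>Cocycles are not assumed normalised. The cocycle identity at (1, 1, v) and (v, 1, 1)
  shows that f(1, v) and f(v, 1) both equal f(1, 1), which is c(1).\<close>

lemma compat_one:
  assumes fc: "compat f c" and v: "v \<in> carrier Q"
  shows "int p dvd f \<one>\<^bsub>Q\<^esub> v - c \<one>" "int p dvd f v \<one>\<^bsub>Q\<^esub> - c \<one>"
proof -
  have 1: "int p dvd f \<one>\<^bsub>Q\<^esub> \<one>\<^bsub>Q\<^esub> - c \<one>" using compatD(3)[OF fc, of \<one> \<one>] by simp
  have "int p dvd f \<one>\<^bsub>Q\<^esub> v - f \<one>\<^bsub>Q\<^esub> \<one>\<^bsub>Q\<^esub>"
    using Q.Z2_cocycle[OF compatD(1)[OF fc], of "\<one>\<^bsub>Q\<^esub>" "\<one>\<^bsub>Q\<^esub>" v] v by simp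
  from dvd_add[OF this 1] show "int p dvd f \<one>\<^bsub>Q\<^esub> v - c \<one>" by simp
  have "int p dvd f \<one>\<^bsub>Q\<^esub> \<one>\<^bsub>Q\<^esub> - f v \<one>\<^bsub>Q\<^esub>"
    using Q.Z2_cocycle[OF compatD(1)[OF fc], of v "\<one>\<^bsub>Q\<^esub>" "\<one>\<^bsub>Q\<^esub>"] v by simp
  from dvd_diff[OF 1 this] show "int p dvd f v \<one>\<^bsub>Q\<^esub> - c \<one>" by simp
qed

text \<open>One argument of f is 1, so f contributes only the constant c(1). Having the same formula
  on both sides is what makes the functional invariant under conjugation by G.\<close>

lemma compat_Phi:
  assumes fc: "compat f c" and a: "a \<in> \<Phi>" and x: "x \<in> carrier G"
  shows "int p dvd c (a \<otimes> x) - (c a - c \<one> + c x)" "int p dvd c (x \<otimes> a) - (c a - c \<one> + c x)"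
proof -
  have a': "a \<in> carrier G" "q a = \<one>\<^bsub>Q\<^esub>" using a by (auto simp: mem_Phi_iff)
  show "int p dvd c (a \<otimes> x) - (c a - c \<one> + c x)"
    using dvd_diff[OF compatD(3)[OF fc a'(1) x] compat_one(1)[OF fc, of "q x"]] x a' by (simp add: algebra_simps)
  show "int p dvd c (x \<otimes> a) - (c a - c \<one> + c x)"
    using dvd_diff[OF compatD(3)[OF fc x a'(1)] compat_one(2)[OF fc, of "q x"]] x a' by (simp add: algebra_simps)
qed

text \<open>The restriction of \<open>c - c(1)\<close> to \<Phi> is a G-invariant homomorphism, so it kills \<open>\<Phi>\<^sup>p[G,\<Phi>]\<close>;
  the map from it to the class of f is the transgression.\<close>
lemma compat_vanishes_on_lpc_three:
  assumes fc: "compat f c" and a: "a \<in> lpc G T p 3"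
  shows "int p dvd c a - c \<one>"
proof -
  define H where "H = \<Phi> \<inter> {x \<in> topspace T. int p dvd c x - c \<one>}"
  have pow: "int p dvd c (x [^] n) - c \<one> - int n * (c x - c \<one>)" if x: "x \<in> \<Phi>" for x and n :: nat
  proof (induction n)
    case (Suc n)
    have "int p dvd c (x [^] Suc n) - (c x - c \<one> + c (x [^] n))"
      using compat_Phi(2)[OF fc x, of "x [^] n"] lpc_two_carrier[OF x] by simp
    from dvd_add[OF Suc this] show ?case by (simp add: algebra_simps)
  qed simp
  have cm: "int p dvd c (comm G g h) - c \<one>" if g: "g \<in> carrier G" and h: "h \<in> \<Phi>" for g h
  proof -
    have h': "h \<in> carrier G" using h lpc_two_carrier by blast
    have "int p dvd c (g \<otimes> h) - (c (comm G g h) - c \<one> + c (h \<otimes> g))"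
      using compat_Phi(2)[OF fc lpc_two_gens(2)[OF g h'], of "h \<otimes> g"] g h' by (simp add: mult_comm)
    from dvd_diff[OF dvd_diff[OF compat_Phi(2)[OF fc h g] compat_Phi(1)[OF fc h g]] this]
    show ?thesis by (simp add: algebra_simps)
  qed
  have "lpc G T p 3 \<subseteq> H"
    unfolding lpc_three
  proof (rule closed_gen_minimal)
    show "subgroup H G"
    proof (rule subgroupI)
      show "H \<subseteq> carrier G" by (auto simp: H_def)
      have "\<one> \<in> H" using subgroup.one_closed[OF subgroup_lpc_two] by (simp add: H_def)
      then show "H \<noteq> {}" by blast
      show "inv x \<in> H" if "x \<in> H" for x
      proof -
        have x: "x \<in> \<Phi>" "x \<in> carrier G" "int p dvd c x - c \<one>" using that by (auto simp: H_def)
        have "int p dvd c \<one> - (c x - c \<one> + c (inv x))" using compat_Phi(1)[OF fc x(1), of "inv x"] x(2) by simp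
        from dvd_add[OF this x(3)] have "int p dvd c \<one> - c (inv x)" by simp
        then have "int p dvd c (inv x) - c \<one>" by (simp add: dvd_diff_commute)
        then show ?thesis using x subgroup.m_inv_closed[OF subgroup_lpc_two x(1)] by (simp add: H_def)
      qed
      show "x \<otimes> y \<in> H" if "x \<in> H" "y \<in> H" for x y
      proof -
        have x: "x \<in> \<Phi>" "x \<in> carrier G" "int p dvd c x - c \<one>" and y: "y \<in> \<Phi>" "y \<in> carrier G" "int p dvd c y - c \<one>"
          using that by (auto simp: H_def)
        from dvd_add[OF dvd_add[OF compat_Phi(1)[OF fc x(1) y(2)] x(3)] y(3)]
        have "int p dvd c (x \<otimes> y) - c \<one>" by (simp add: algebra_simps)
        then show ?thesis using x y subgroup.m_closed[OF subgroup_lpc_two x(1) y(1)] by (simp add: H_def)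
      qed
    qed
    show "closedin T H"
      unfolding H_def by (intro closedin_Int closedin_lpc_two closedin_discrete_vimage[OF compatD(2)[OF fc]])
    have "x [^] p \<in> H" if "x \<in> \<Phi>" for x
      using dvd_add[OF pow[OF that, of p], of "int p * (c x - c \<one>)"] lpc_two_carrier[OF that] lpc_two_gens(1)[of x] by (simp add: H_def)
    moreover have "comm G g h \<in> H" if "g \<in> carrier G" "h \<in> \<Phi>" for g h
      using that cm[OF that] lpc_two_carrier[OF that(2)] lpc_two_gens(2)[of g h] by (simp add: H_def)
    ultimately show "{x [^] p | x. x \<in> \<Phi>} \<union> {comm G g h | g h. g \<in> carrier G \<and> h \<in> \<Phi>} \<subseteq> H"
      by blast
  qed
  then show ?thesis using a by (auto simp: H_def)
qed

text \<open>Two witnesses for the same f differ by a continuous homomorphism from G to Z/p, and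
  these vanish on \<Phi>.\<close>

lemma compat_unique:
  assumes "compat f c" "compat f c'" "a \<in> \<Phi>"
  shows "int p dvd (c a - c \<one>) - (c' a - c' \<one>)"
proof -
  define e where "e x = (c x - c' x) mod int p" for x
  have e: "e b = 0" if "b \<in> \<Phi>" for b
  proof (rule hom_vanishes_on_lpc_two[OF _ _ that])
    show "cont_fun T p e" unfolding e_def
      by (rule cont_fun_mod2[where F = "(-)"]) (use assms compatD in blast)+
    fix x y assume xy: "x \<in> carrier G" "y \<in> carrier G"
    have "int p dvd (c (x \<otimes> y) - c' (x \<otimes> y)) - ((c x - c' x) + (c y - c' y))"
      using dvd_diff[OF compatD(3)[OF assms(1) xy] compatD(3)[OF assms(2) xy]] by (simp add: algebra_simps)
    then show "int p dvd e (x \<otimes> y) - (e x + e y)"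
      by (simp add: e_def mod_eq_dvd_iff[symmetric] mod_simps)
  qed
  have "int p dvd c a - c' a" using e[OF assms(3)] by (simp add: e_def mod_eq_0_iff_dvd)
  moreover have "int p dvd c \<one> - c' \<one>"
    using e[OF subgroup.one_closed[OF subgroup_lpc_two]] by (simp add: e_def mod_eq_0_iff_dvd)
  ultimately have "int p dvd (c a - c' a) - (c \<one> - c' \<one>)" by (rule dvd_diff)
  then show ?thesis by (simp add: algebra_simps)
qed

text \<open>Changing f by the coboundary of d changes c by the pullback of d along q, which is
  constant on \<Phi> and so cancels in c - c(1).\<close>

lemma compat_cls:
  assumes fc: "compat f c" and g: "g \<in> cls Q TQ p f"
  obtains c' where "compat g c'" "\<And>a. a \<in> \<Phi> \<Longrightarrow> int p dvd (c' a - c' \<one>) - (c a - c \<one>)"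
proof -
  obtain d where d: "g \<in> Z2 Q TQ p" "cont_fun TQ p d" and
    d3': "\<forall>u\<in>carrier Q. \<forall>v\<in>carrier Q. int p dvd g u v - f u v - (d u + d v - d (u \<otimes>\<^bsub>Q\<^esub> v))"
    using iffD1[OF Q.mem_cls_iff[OF compatD(1)[OF fc]] g] by (elim conjE exE)
  have d3: "int p dvd g u v - f u v - (d u + d v - d (u \<otimes>\<^bsub>Q\<^esub> v))"
    if "u \<in> carrier Q" "v \<in> carrier Q" for u v by (rule bspec[OF bspec[OF d3' that(1)] that(2)])
  define c' where "c' x = (c x + d (q x)) mod int p" for x
  have cc: "int p dvd c' x - (c x + d (q x))" for x by (simp add: c'_def mod_eq_dvd_iff[symmetric])
  show thesis
  proof
    show "compat g c'"
      unfolding compat_def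
    proof (intro conjI ballI)
      show "cont_fun T p c'" unfolding c'_def
        by (rule cont_fun_mod2[OF compatD(2)[OF fc] cont_fun_q[OF d(2)], of "(+)"])
      fix x y assume xy: "x \<in> carrier G" "y \<in> carrier G"
      have A: "int p dvd g (q x) (q y) - f (q x) (q y) - (d (q x) + d (q y) - d (q (x \<otimes> y)))" using d3[of "q x" "q y"] xy by simp
      have B: "int p dvd g (q x) (q y) - ((c x + d (q x)) + (c y + d (q y)) - (c (x \<otimes> y) + d (q (x \<otimes> y))))"
        using dvd_add[OF A compatD(3)[OF fc xy]] xy by (simp add: algebra_simps)
      from dvd_add[OF dvd_diff[OF dvd_diff[OF B cc[of x]] cc[of y]] cc[of "x \<otimes> y"]]
      show "int p dvd g (q x) (q y) - (c' x + c' y - c' (x \<otimes> y))"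
        by (simp add: algebra_simps)
    qed (fact d(1))
    fix a assume "a \<in> \<Phi>"
    then show "int p dvd (c' a - c' \<one>) - (c a - c \<one>)"
      using dvd_diff[OF cc[of a] cc[of \<one>]] by (simp add: mem_Phi_iff algebra_simps)
  qed
qed

lemma compat_add:
  assumes fc: "compat f c" and gd: "compat g d"
  shows "compat (\<lambda>u v. (f u v + g u v) mod int p) (\<lambda>x. (c x + d x) mod int p)"
  unfolding compat_def
proof (intro conjI ballI)
  show "cont_fun T p (\<lambda>x. (c x + d x) mod int p)"
    by (rule cont_fun_mod2[OF compatD(2)[OF fc] compatD(2)[OF gd], of "(+)"])
  fix x y assume xy: "x \<in> carrier G" "y \<in> carrier G"
  have cc: "int p dvd (a::int) mod int p - a" for a by (simp add: mod_eq_dvd_iff[symmetric])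
  have "int p dvd (f (q x) (q y) + g (q x) (q y)) - ((c x + d x) + (c y + d y) - (c (x \<otimes> y) + d (x \<otimes> y)))"
    using dvd_add[OF compatD(3)[OF fc xy] compatD(3)[OF gd xy]] by (simp add: algebra_simps)
  from dvd_add[OF dvd_add[OF dvd_diff[OF dvd_diff[OF this cc[of "c x + d x"]] cc[of "c y + d y"]] cc[of "c (x \<otimes> y) + d (x \<otimes> y)"]]
     cc[of "f (q x) (q y) + g (q x) (q y)"]]
  show "int p dvd (f (q x) (q y) + g (q x) (q y)) mod int p -
      ((c x + d x) mod int p + (c y + d y) mod int p - (c (x \<otimes> y) + d (x \<otimes> y)) mod int p)"
    by (simp add: algebra_simps)
qed (use Q.Z2_add compatD(1)[OF fc] compatD(1)[OF gd] in blast)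

lemma compat_uminus:
  assumes fc: "compat f c"
  shows "compat (\<lambda>u v. (- f u v) mod int p) (\<lambda>x. (- c x) mod int p)"
  unfolding compat_def
proof (intro conjI ballI)
  show "cont_fun T p (\<lambda>x. (- c x) mod int p)"
    by (rule cont_fun_mod1[OF compatD(2)[OF fc], of uminus])
  fix x y assume xy: "x \<in> carrier G" "y \<in> carrier G"
  have cc: "int p dvd (a::int) mod int p - a" for a by (simp add: mod_eq_dvd_iff[symmetric])
  from dvd_add[OF dvd_diff[OF dvd_diff[OF dvd_diff[OF cc[of "- f (q x) (q y)"] cc[of "- c x"]] cc[of "- c y"]]
     compatD(3)[OF fc xy]] cc[of "- c (x \<otimes> y)"]]
  show "int p dvd (- f (q x) (q y)) mod int p - ((- c x) mod int p + (- c y) mod int p - (- c (x \<otimes> y)) mod int p)"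
    by (simp add: algebra_simps)
qed (use Q.Z2_uminus compatD(1)[OF fc] in blast)

text \<open>Injectivity of the transgression.\<close>
lemma compat_trivial:
  assumes fc: "compat f c" and triv: "\<And>a. a \<in> \<Phi> \<Longrightarrow> int p dvd c a - c \<one>"
  shows "f \<in> B2 Q TQ p"
proof -
  have inv: "c (a \<otimes> x) = c x" if a: "a \<in> \<Phi>" and x: "x \<in> carrier G" for a x
  proof (rule eq_of_dvd_diff)
    show "int p dvd c (a \<otimes> x) - c x"
      using dvd_add[OF compat_Phi(1)[OF fc a x] triv[OF a]] by (simp add: algebra_simps)
  qed (use cont_fun_range[OF compatD(2)[OF fc]] x lpc_two_carrier[OF a] in auto)
  obtain d where d: "cont_fun TQ p d" "\<forall>x\<in>carrier G. d (q x) = c x"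
    by (rule cont_fun_descend[OF compatD(2)[OF fc] inv]) (simp_all add: that)
  have "int p dvd f u v - (d u + d v - d (u \<otimes>\<^bsub>Q\<^esub> v))" if uv: "u \<in> carrier Q" "v \<in> carrier Q" for u v
  proof -
    obtain x y where "x \<in> carrier G" "u = q x" "y \<in> carrier G" "v = q y" using uv q_surj by blast
    then show ?thesis using compatD(3)[OF fc, of x y] bspec[OF d(2), of "x \<otimes> y"] d(2) by simp
  qed
  then show ?thesis using Q.mem_B2_iff[OF compatD(1)[OF fc]] d(1) by blast
qed

text \<open>\<open>infl\<close> inflates a representative picked by \<open>SOME\<close>;
  \<open>compat_cls\<close> carries a witness from any representative of the class to that
  one.\<close>

lemma mem_kernel_infl_iff:
  "C \<in> kernel (H2 Q TQ p) (H2 G T p) (infl Q G T p q) \<longleftrightarrow> (\<exists>f c. compat f c \<and> C = cls Q TQ p f)"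
proof -
  let ?pull = "\<lambda>f x y. if x \<in> carrier G \<and> y \<in> carrier G then f (q x) (q y) else 0"
  have pull_Z2: "?pull f \<in> Z2 G T p" if f: "f \<in> Z2 Q TQ p" for f
  proof (rule Z2I)
    show "cont_fun (prod_topology T T) p (\<lambda>(x, y). ?pull f x y)"
      by (rule continuous_map_discrete_eq[OF continuous_map_compose[OF quotient_imp_continuous_map[OF quotient_map_qq] Q.Z2_cont[OF f]]])
        auto
    fix g h k assume "g \<in> carrier G" "h \<in> carrier G" "k \<in> carrier G"
    then show "int p dvd ?pull f h k - ?pull f (g \<otimes> h) k + ?pull f g (h \<otimes> k) - ?pull f g h"
      using Q.Z2_cocycle[OF f, of "q g" "q h" "q k"] by simp
  qed auto
  have pull: "?pull f \<in> B2 G T p \<longleftrightarrow> (\<exists>c. compat f c)" if f: "f \<in> Z2 Q TQ p" for f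
    unfolding mem_B2_iff[OF pull_Z2[OF f]] compat_def using f by auto
  show ?thesis
  proof
    assume "C \<in> kernel (H2 Q TQ p) (H2 G T p) (infl Q G T p q)"
    then obtain f0 where f0: "f0 \<in> Z2 Q TQ p" "C = cls Q TQ p f0"
      and infl: "infl Q G T p q C = \<one>\<^bsub>H2 G T p\<^esub>"
      by (auto simp: kernel_def Q.carrier_H2)
    define f where "f = (SOME f. f \<in> C)"
    have fC: "f \<in> C" unfolding f_def using Q.cls_self[OF f0(1)] f0(2) by (metis someI)
    then have f: "f \<in> Z2 Q TQ p" "cls Q TQ p f = C"
      using f0 Q.mem_cls_iff[OF f0(1)] Q.cls_eqI[OF f0(1)] by auto
    have "cls G T p (?pull f) = \<one>\<^bsub>H2 G T p\<^esub>" using infl unfolding infl_def f_def Let_def .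
    then show "\<exists>f c. compat f c \<and> C = cls Q TQ p f"
      using cls_eq_one_iff[OF pull_Z2[OF f(1)]] pull[OF f(1)] f(2) by blast
  next
    assume "\<exists>f c. compat f c \<and> C = cls Q TQ p f"
    then obtain f0 c where fc: "compat f0 c" and C: "C = cls Q TQ p f0" by blast
    define f where "f = (SOME f. f \<in> C)"
    have fC: "f \<in> C" unfolding f_def using Q.cls_self[OF compatD(1)[OF fc]] C by (metis someI)
    obtain c' where c': "compat f c'" using compat_cls[OF fc] fC C by blast
    have "cls G T p (?pull f) = \<one>\<^bsub>H2 G T p\<^esub>"
      using cls_eq_one_iff[OF pull_Z2[OF compatD(1)[OF c']]] pull[OF compatD(1)[OF c']] c' by blast
    then have "infl Q G T p q C = \<one>\<^bsub>H2 G T p\<^esub>" unfolding infl_def f_def Let_def .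
    then show "C \<in> kernel (H2 Q TQ p) (H2 G T p) (infl Q G T p q)"
      using compatD(1)[OF fc] by (auto simp: kernel_def Q.carrier_H2 C)
  qed
qed

end

text \<open>Over a field, a functional vanishing on the common kernel of finitely many others is a
  linear combination of them. The family L need only be closed under sums, since natural numbers
  represent all scalars modulo p. V varies because the induction on F passes to the kernel of one
  functional.\<close>

lemma (in group) functional_in_span:
  fixes p :: nat and \<theta> :: "'a \<Rightarrow> int"
  assumes p: "Factorial_Ring.prime p" and W: "subgroup W G"
    and L0: "(\<lambda>x. 0) \<in> L" and Ladd: "\<And>l m. l \<in> L \<Longrightarrow> m \<in> L \<Longrightarrow> (\<lambda>x. l x + m x) \<in> L"
    and Lhom: "\<And>l x y. l \<in> L \<Longrightarrow> x \<in> W \<Longrightarrow> y \<in> W \<Longrightarrow> int p dvd l (x \<otimes> y) - (l x + l y)"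
    and \<theta>: "\<And>x y. x \<in> W \<Longrightarrow> y \<in> W \<Longrightarrow> int p dvd \<theta> (x \<otimes> y) - (\<theta> x + \<theta> y)"
    and F: "finite F" "F \<subseteq> L" and V: "subgroup V G" "V \<subseteq> W"
    and ker: "\<And>x. x \<in> V \<Longrightarrow> (\<And>l. l \<in> F \<Longrightarrow> int p dvd l x) \<Longrightarrow> int p dvd \<theta> x"
  obtains l where "l \<in> L" "\<And>x. x \<in> V \<Longrightarrow> int p dvd \<theta> x - l x"
proof -
  have hom_pow: "int p dvd l (x [^] n) - int n * l x"
    if l: "\<And>x y. x \<in> W \<Longrightarrow> y \<in> W \<Longrightarrow> int p dvd l (x \<otimes> y) - (l x + l y)" and x: "x \<in> W" for l x and n :: nat
  proof (induction n)
    case 0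
    show ?case using l[of \<one> \<one>] subgroup.one_closed[OF W] by simp
  next
    case (Suc n)
    have "x [^] n \<in> W" using x W by (induction n) (auto simp: subgroup.one_closed subgroup.m_closed)
    from dvd_add[OF Suc l[OF this x]] show ?case by (simp add: algebra_simps)
  qed
  have Lmult: "(\<lambda>x. int n * l x) \<in> L" if "l \<in> L" for l and n :: nat
  proof (induction n)
    case (Suc n)
    from Ladd[OF Suc that] show ?case by (simp add: algebra_simps)
  qed (use L0 in simp)
  have "\<exists>l\<in>L. \<forall>x\<in>V. int p dvd \<theta> x - l x"
    using F V ker
  proof (induction F arbitrary: V rule: finite_induct)
    case empty
    then show ?case using L0 by (intro bexI[of _ "\<lambda>x. 0"]) auto
  next
    case (insert l0 F)
    note l0 = Lhom[of l0]
    have l0L: "l0 \<in> L" using insert.prems by simp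
    have VW: "x \<in> W" if "x \<in> V" for x using that insert.prems by blast
    \<comment> \<open>On the kernel of l0 in V the hypothesis for F alone applies and yields l
      agreeing with \<theta> there; what remains is to correct l by a multiple of l0.\<close>
    define V' where "V' = {x \<in> V. int p dvd l0 x}"
    have l0one: "int p dvd l0 \<one>" using l0[OF l0L, of \<one> \<one>] subgroup.one_closed[OF W] by simp
    have "subgroup V' G"
    proof (rule subgroupI)
      show "V' \<subseteq> carrier G" using insert.prems(2) subgroup.subset by (auto simp: V'_def)
      have "\<one> \<in> V'" using l0one subgroup.one_closed[OF insert.prems(2)] by (simp add: V'_def)
      then show "V' \<noteq> {}" by blast
      fix x assume x: "x \<in> V'"
      then have xV: "x \<in> V" "inv x \<in> V" "int p dvd l0 x" "x \<in> carrier G"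
        using insert.prems(2) by (auto simp: V'_def subgroup.m_inv_closed subgroup.mem_carrier)
      have "int p dvd l0 \<one> - (l0 x + l0 (inv x))" using l0[OF l0L, of x "inv x"] xV VW by simp
      from dvd_diff[OF dvd_diff[OF l0one this] xV(3)] show "inv x \<in> V'" using xV by (simp add: V'_def)
      fix y assume y: "y \<in> V'"
      then have yV: "y \<in> V" "int p dvd l0 y" by (auto simp: V'_def)
      from dvd_add[OF l0[OF l0L VW[OF xV(1)] VW[OF yV(1)]] dvd_add[OF xV(3) yV(2)]]
      show "x \<otimes> y \<in> V'" using subgroup.m_closed[OF insert.prems(2) xV(1) yV(1)] by (simp add: V'_def)
    qed
    moreover have "int p dvd \<theta> x" if "x \<in> V'" "\<And>l. l \<in> F \<Longrightarrow> int p dvd l x" for x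
      using that insert.prems(4)[of x] by (auto simp: V'_def)
    ultimately obtain l where l: "l \<in> L" and l_eq: "\<And>x. x \<in> V' \<Longrightarrow> int p dvd \<theta> x - l x"
      using insert.IH[of V'] insert.prems VW by (auto simp: V'_def)
    show ?case
    proof (cases "\<exists>v\<in>V. \<not> int p dvd l0 v")
      case False
      then show ?thesis using l l_eq by (auto simp: V'_def)
    next
      case True
      then obtain v where v: "v \<in> V" "\<not> int p dvd l0 v" by blast
      obtain m n where mn: "l0 v * m + int p * n = 1" using bezout_prime[OF p v(2)] by blast
      have p0: "int p > 0" using prime_gt_0_nat[OF p] by simp
      \<comment> \<open>As m inverts l0(v) modulo p, k represents the scalar (\<theta> - l)(v) /
        l0(v), the only one that makes the correction right at v.\<close>
      define k where "k = nat ((m * (\<theta> v - l v)) mod int p)"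
      have k: "int p dvd int k - m * (\<theta> v - l v)"
        using p0 by (simp add: k_def mod_eq_dvd_iff[symmetric])
      have "int p dvd \<theta> x - (l x + int k * l0 x)" if x: "x \<in> V" for x
      proof -
        \<comment> \<open>r represents -l0(x) / l0(v), so x v^r lies in V', where \<theta> and l
          agree; this carries the comparison from x to v.\<close>
        define r where "r = nat ((- l0 x * m) mod int p)"
        have r: "int p dvd int r - (- l0 x * m)"
        proof -
          have "int r = (- l0 x * m) mod int p" using p0 by (simp add: r_def)
          then show ?thesis by (simp only: dvd_mod_cancel) simp
        qed
        define y where "y = v [^] r"
        have y: "y \<in> V" unfolding y_def using v(1) insert.prems(2)
          by (induction r) (auto simp: subgroup.one_closed subgroup.m_closed)
        obtain r' where r': "int r = - l0 x * m + int p * r'" using r by (metis dvdE diff_eq_eq add.commute)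
        obtain k' where k': "int k = m * (\<theta> v - l v) + int p * k'" using k by (metis dvdE diff_eq_eq add.commute)
        have l0y: "int p dvd l0 y - int r * l0 v"
          and ly: "int p dvd l y - int r * l v" and ty: "int p dvd \<theta> y - int r * \<theta> v"
          unfolding y_def using hom_pow[OF l0[OF l0L] VW[OF v(1)]] hom_pow[OF Lhom[OF l] VW[OF v(1)]]
            hom_pow[OF \<theta> VW[OF v(1)]] by auto
        have rl: "int r * l0 v + l0 x = int p * (r' * l0 v + l0 x * n)"
        proof -
          have "int r * l0 v + l0 x = - l0 x * (l0 v * m) + int p * r' * l0 v + l0 x" by (simp add: r' algebra_simps)
          also have "l0 v * m = 1 - int p * n" using mn by simp
          finally show ?thesis by (simp add: algebra_simps)
        qed
        have "int p dvd l0 (x \<otimes> y)"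
          using dvd_add[OF dvd_add[OF l0[OF l0L VW[OF x] VW[OF y]] l0y] dvd_triv_left[of "int p" "r' * l0 v + l0 x * n", folded rl]]
          by (simp add: algebra_simps)
        then have xy: "x \<otimes> y \<in> V'" using subgroup.m_closed[OF insert.prems(2) x y] by (simp add: V'_def)
        have "int p dvd (\<theta> x + \<theta> y) - (l x + l y)"
          using dvd_add[OF dvd_diff[OF l_eq[OF xy] \<theta>[OF VW[OF x] VW[OF y]]] Lhom[OF l VW[OF x] VW[OF y]]] by (simp add: algebra_simps)
        from dvd_add[OF dvd_diff[OF this ty] ly]
        have 1: "int p dvd \<theta> x - l x + int r * (\<theta> v - l v)" by (simp add: algebra_simps)
        have 2: "\<theta> x - (l x + int k * l0 x) = (\<theta> x - l x + int r * (\<theta> v - l v)) - int p * (r' * (\<theta> v - l v) + k' * l0 x)"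
          by (simp add: r' k' algebra_simps)
        show ?thesis unfolding 2 by (rule dvd_diff[OF 1 dvd_triv_left])
      qed
      then show ?thesis using Ladd[OF l Lmult[OF l0L, of k]] by (intro bexI[of _ "\<lambda>x. l x + int k * l0 x"] ballI)
    qed
  qed
  then show thesis using that by blast
qed

section \<open>Extension of invariant functionals from \<Phi> to G\<close>

context frattini_quotient begin

text \<open>Surjectivity of the transgression onto the kernel of inflation: an invariant functional on \<Phi>
  extends to a cochain on G along representatives of the double cosets \<open>\<Phi> g U\<close>.\<close>
lemma ex_compat_nonzero:
  assumes x: "x \<in> \<Phi>" "x \<notin> lpc G T p 3"
  obtains f c where "compat f c" "\<not> int p dvd c x - c \<one>"
proof -
  obtain U \<theta> where U: "subgroup U G" "openin T U"
    and \<theta>_range: "\<And>v. v \<in> \<Phi> \<Longrightarrow> \<theta> v \<in> {0..<int p}"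
    and \<theta>_add: "\<And>v w. v \<in> \<Phi> \<Longrightarrow> w \<in> \<Phi> \<Longrightarrow> int p dvd \<theta> (v \<otimes> w) - (\<theta> v + \<theta> w)"
    and \<theta>_three: "\<And>w. w \<in> lpc G T p 3 \<Longrightarrow> \<theta> w = 0"
    and \<theta>_U: "\<And>u. u \<in> U \<Longrightarrow> u \<in> \<Phi> \<Longrightarrow> \<theta> u = 0" and \<theta>x: "\<theta> x \<noteq> 0"
    by (rule ex_continuous_functional_nonzero[OF prime_p subgroup_lpc_two subgroup_lpc_three
          closedin_lpc_three lpc_three_subset lpc_three_gens(1) lpc_three_gens(2) x]) (use lpc_two_carrier in blast)+
  note Uc = subgroup.mem_carrier[OF U(1)] and Pc = lpc_two_carrier
  note Pm = subgroup.m_closed[OF subgroup_lpc_two] and Pi = subgroup.m_inv_closed[OF subgroup_lpc_two]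
  \<comment> \<open>The element g v g^-1 v^-1 lies in [G, \<Phi>], hence in G^(3,p), where \<theta>
    vanishes.\<close>
  have \<theta>_conj: "\<theta> (g \<otimes> v \<otimes> inv g) = \<theta> v" if g: "g \<in> carrier G" and v: "v \<in> \<Phi>" for g v
  proof (rule eq_of_dvd_diff)
    have L: "comm G (inv g) (inv v) \<in> lpc G T p 3" using lpc_three_gens(2) g Pi[OF v] by simp
    moreover have "g \<otimes> v \<otimes> inv g = comm G (inv g) (inv v) \<otimes> v"
      using g Pc[OF v] by (simp add: comm_def m_assoc)
    ultimately show "int p dvd \<theta> (g \<otimes> v \<otimes> inv g) - \<theta> v"
      using \<theta>_add[OF _ v, of "comm G (inv g) (inv v)"] \<theta>_three[OF L] lpc_three_subset by auto
  qed (use \<theta>_range Phi_conj g v in auto)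
  define D where "D g = {a \<otimes> g \<otimes> u | a u. a \<in> \<Phi> \<and> u \<in> U}" for g
  have D_self: "g \<in> D g" if "g \<in> carrier G" for g
  proof -
    have "g = \<one> \<otimes> g \<otimes> \<one>" using that by simp
    then show ?thesis unfolding D_def using subgroup.one_closed[OF U(1)] subgroup.one_closed[OF subgroup_lpc_two] by blast
  qed
  have D_sub: "D (a \<otimes> g \<otimes> u) \<subseteq> D g" if "g \<in> carrier G" "a \<in> \<Phi>" "u \<in> U" for a g u
  proof
    fix z assume "z \<in> D (a \<otimes> g \<otimes> u)"
    then obtain b w where "b \<in> \<Phi>" "w \<in> U" "z = b \<otimes> (a \<otimes> g \<otimes> u) \<otimes> w" unfolding D_def by blast
    moreover from this have "z = (b \<otimes> a) \<otimes> g \<otimes> (u \<otimes> w)" using that Pc Uc by (simp add: m_assoc)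
    ultimately show "z \<in> D g" unfolding D_def using that Pm subgroup.m_closed[OF U(1)] by blast
  qed
  have D_eq: "D (a \<otimes> g \<otimes> u) = D g" if g: "g \<in> carrier G" and a: "a \<in> \<Phi>" and u: "u \<in> U" for a g u
  proof
    have "g = inv a \<otimes> (a \<otimes> g \<otimes> u) \<otimes> inv u" using g Pc[OF a] Uc[OF u] by (simp add: m_assoc) (simp add: m_assoc[symmetric])
    then show "D g \<subseteq> D (a \<otimes> g \<otimes> u)"
      using D_sub[of "a \<otimes> g \<otimes> u" "inv a" "inv u"] g Pc[OF a] Uc[OF u] Pi[OF a] subgroup.m_inv_closed[OF U(1) u] by simp
  qed (rule D_sub[OF that])
  \<comment> \<open>The choice is made from the set \<open>D g\<close>, so all elements of one
    double coset receive the same representative.\<close>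
  define r where "r g = (SOME r. r \<in> D g)" for g
  have r_D: "r g \<in> D g" if "g \<in> carrier G" for g
    unfolding r_def using D_self[OF that] by (rule someI)
  have r_c: "r g \<in> carrier G" if "g \<in> carrier G" for g
    using r_D[OF that] that Pc Uc unfolding D_def by auto
  have r_decomp: "\<exists>a. a \<in> \<Phi> \<and> (\<exists>u\<in>U. g = a \<otimes> r g \<otimes> u)" if g: "g \<in> carrier G" for g
  proof -
    obtain a u where au: "a \<in> \<Phi>" "u \<in> U" "r g = a \<otimes> g \<otimes> u" using r_D[OF g] unfolding D_def by blast
    then have "g = inv a \<otimes> r g \<otimes> inv u"
      using g Pc[OF au(1)] Uc[OF au(2)] by (simp add: m_assoc) (simp add: m_assoc[symmetric])
    then show ?thesis using Pi[OF au(1)] subgroup.m_inv_closed[OF U(1) au(2)] by blast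
  qed
  define c where "c g = \<theta> (SOME a. a \<in> \<Phi> \<and> (\<exists>u\<in>U. g = a \<otimes> r g \<otimes> u))" for g
  \<comment> \<open>If a r w = b r u, then b^-1 a is conjugate under r to u w^-1, which lies in U
    \<inter> \<Phi>. Invariance of \<theta> and its vanishing there give \<theta>(a) = \<theta>(b),
    so any decomposition may be used to compute c.\<close>
  have c_eq: "c g = \<theta> b" if g: "g \<in> carrier G" and b: "b \<in> \<Phi>" "u \<in> U" "g = b \<otimes> r g \<otimes> u" for g b u
  proof -
    define a where "a = (SOME a. a \<in> \<Phi> \<and> (\<exists>u\<in>U. g = a \<otimes> r g \<otimes> u))"
    have "a \<in> \<Phi> \<and> (\<exists>u\<in>U. g = a \<otimes> r g \<otimes> u)" unfolding a_def by (rule someI_ex[OF r_decomp[OF g]])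
    then obtain w where a: "a \<in> \<Phi>" "w \<in> U" "g = a \<otimes> r g \<otimes> w" by blast
    let ?r = "r g"
    have cc: "a \<in> carrier G" "b \<in> carrier G" "u \<in> carrier G" "w \<in> carrier G" "?r \<in> carrier G"
      using a b Pc Uc r_c[OF g] by auto
    have "a \<otimes> ?r \<otimes> w = b \<otimes> ?r \<otimes> u" using a(3) b(3) by metis
    then have "inv b \<otimes> (a \<otimes> ?r \<otimes> w) \<otimes> inv w = inv b \<otimes> (b \<otimes> ?r \<otimes> u) \<otimes> inv w" by simp
    then have "inv b \<otimes> a \<otimes> ?r = ?r \<otimes> (u \<otimes> inv w)"
      using cc by (simp add: m_assoc) (simp add: m_assoc[symmetric])
    then have eq: "inv ?r \<otimes> (inv b \<otimes> a) \<otimes> inv (inv ?r) = u \<otimes> inv w"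
      using cc by (simp add: m_assoc) (simp add: m_assoc[symmetric])
    have ba: "inv b \<otimes> a \<in> \<Phi>" using a b Pm Pi by simp
    have "u \<otimes> inv w \<in> U" using a b U(1) by (simp add: subgroup.m_closed subgroup.m_inv_closed)
    moreover have "u \<otimes> inv w \<in> \<Phi>" using Phi_conj[OF ba, of "inv ?r"] cc unfolding eq by simp
    ultimately have "\<theta> (inv b \<otimes> a) = 0" using \<theta>_conj[OF _ ba, of "inv ?r"] cc \<theta>_U unfolding eq by simp
    then have "int p dvd \<theta> a - \<theta> b"
      using \<theta>_add[OF b(1) ba] cc by (simp add: m_assoc[symmetric])
    then have "\<theta> a = \<theta> b" by (rule eq_of_dvd_diff) (use \<theta>_range a b in auto)
    then show ?thesis by (simp add: c_def a_def)
  qed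
  have c_range: "c g \<in> {0..<int p}" if g: "g \<in> carrier G" for g
    using r_decomp[OF g] c_eq[OF g] \<theta>_range by metis
  have c_right: "c (g \<otimes> u) = c g" if g: "g \<in> carrier G" and u: "u \<in> U" for g u
  proof -
    obtain a w where a: "a \<in> \<Phi>" "w \<in> U" "g = a \<otimes> r g \<otimes> w" using r_decomp[OF g] by blast
    have "D (g \<otimes> u) = D g" using D_eq[OF g subgroup.one_closed[OF subgroup_lpc_two] u] g Uc[OF u] by simp
    then have rr: "r (g \<otimes> u) = r g" by (simp add: r_def)
    have "g \<otimes> u = a \<otimes> r g \<otimes> w \<otimes> u" using a(3) by simp
    also have "\<dots> = a \<otimes> r g \<otimes> (w \<otimes> u)" using Pc[OF a(1)] Uc[OF a(2)] Uc[OF u] r_c[OF g] by (simp add: m_assoc)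
    finally have "g \<otimes> u = a \<otimes> r (g \<otimes> u) \<otimes> (w \<otimes> u)" unfolding rr .
    from c_eq[OF _ a(1) _ this] c_eq[OF g a] show ?thesis
      using g Uc[OF u] subgroup.m_closed[OF U(1) a(2) u] by simp
  qed
  have c_left: "int p dvd c (v \<otimes> g) - (\<theta> v + c g)" if g: "g \<in> carrier G" and v: "v \<in> \<Phi>" for g v
  proof -
    obtain a w where a: "a \<in> \<Phi>" "w \<in> U" "g = a \<otimes> r g \<otimes> w" using r_decomp[OF g] by blast
    have "D (v \<otimes> g) = D g" using D_eq[OF g v subgroup.one_closed[OF U(1)]] g Pc[OF v] by simp
    then have rr: "r (v \<otimes> g) = r g" by (simp add: r_def)
    have "v \<otimes> g = v \<otimes> (a \<otimes> r g \<otimes> w)" using a(3) by simp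
    also have "\<dots> = (v \<otimes> a) \<otimes> r g \<otimes> w" using Pc[OF a(1)] Uc[OF a(2)] Pc[OF v] r_c[OF g] by (simp add: m_assoc)
    finally have "v \<otimes> g = (v \<otimes> a) \<otimes> r (v \<otimes> g) \<otimes> w" unfolding rr .
    from c_eq[OF _ Pm[OF v a(1)] a(2) this] c_eq[OF g a] show ?thesis
      using g Pc[OF v] \<theta>_add[OF v a(1)] by simp
  qed
  have c_cont: "cont_fun T p c"
    unfolding continuous_map_discrete_iff
  proof (intro conjI ballI)
    show "c ` topspace T \<subseteq> {0..<int p}" using c_range by auto
    fix g assume "g \<in> topspace T"
    then have g: "g \<in> carrier G" by simp
    have "g \<in> (\<lambda>u. g \<otimes> u) ` U" using subgroup.one_closed[OF U(1)] g by (force simp: image_iff)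
    moreover have "\<forall>y\<in>(\<lambda>u. g \<otimes> u) ` U. c y = c g" using c_right[OF g] by simp
    ultimately show "\<exists>V. openin T V \<and> g \<in> V \<and> (\<forall>y\<in>V. c y = c g)" using openin_lmult[OF g U(2)] by blast
  qed
  \<comment> \<open>Moving b past y replaces it by y b y^-1, which has the same value under
    \<theta>. All values of \<theta> then cancel, so the coboundary of c depends only on the images
    in Q and descends to a cocycle f.\<close>
  have inv: "cobdry G p c (a \<otimes> y) (b \<otimes> z) = cobdry G p c y z"
    if "a \<in> \<Phi>" "b \<in> \<Phi>" "y \<in> carrier G" "z \<in> carrier G" for a b y z
  proof -
    note ab = that(1,2) and yz = that(3,4)
    have b': "y \<otimes> b \<otimes> inv y \<in> \<Phi>" by (rule Phi_conj[OF ab(2) yz(1)])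
    have "(a \<otimes> y) \<otimes> (b \<otimes> z) = (a \<otimes> (y \<otimes> b \<otimes> inv y)) \<otimes> (y \<otimes> z)"
      using Pc ab yz by (simp add: m_assoc) (simp add: m_assoc[symmetric])
    then have "int p dvd c ((a \<otimes> y) \<otimes> (b \<otimes> z)) - (\<theta> (a \<otimes> (y \<otimes> b \<otimes> inv y)) + c (y \<otimes> z))"
      using c_left[OF _ Pm[OF ab(1) b'], of "y \<otimes> z"] yz by simp
    from dvd_add[OF this \<theta>_add[OF ab(1) b']]
    have 3: "int p dvd c ((a \<otimes> y) \<otimes> (b \<otimes> z)) - (\<theta> a + \<theta> b + c (y \<otimes> z))"
      using \<theta>_conj[OF yz(1) ab(2)] by (simp add: algebra_simps)
    from dvd_diff[OF dvd_add[OF c_left[OF yz(1) ab(1)] c_left[OF yz(2) ab(2)]] 3]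
    have "int p dvd (c (a \<otimes> y) + c (b \<otimes> z) - c ((a \<otimes> y) \<otimes> (b \<otimes> z))) - (c y + c z - c (y \<otimes> z))"
      by (simp add: algebra_simps)
    then show ?thesis using ab yz Pc by (simp add: cobdry_eq mod_eq_dvd_iff)
  qed
  obtain F where F: "cont_fun (prod_topology TQ TQ) p F"
    "\<And>z. z \<in> topspace (prod_topology T T) \<Longrightarrow> F (q (fst z), q (snd z)) = (case z of (y, z) \<Rightarrow> cobdry G p c y z)"
    "\<And>z. z \<notin> topspace (prod_topology TQ TQ) \<Longrightarrow> F z = 0"
  proof (rule quotient_map_descend[OF quotient_map_qq Z2_cont[OF Z2_cobdry[OF c_cont]]])
    fix y z assume yz: "y \<in> topspace (prod_topology T T)" "z \<in> topspace (prod_topology T T)"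
      "(q (fst y), q (snd y)) = (q (fst z), q (snd z))"
    obtain y1 y2 z1 z2 where [simp]: "y = (y1, y2)" "z = (z1, z2)" by (metis surj_pair)
    obtain a where a: "a \<in> \<Phi>" "z1 = a \<otimes> y1" using q_eqE[of y1 z1] yz by auto
    obtain b where b: "b \<in> \<Phi>" "z2 = b \<otimes> y2" using q_eqE[of y2 z2] yz by auto
    show "(case y of (y, z) \<Rightarrow> cobdry G p c y z) = (case z of (y, z) \<Rightarrow> cobdry G p c y z)"
      using inv[OF a(1) b(1), of y1 y2] a b yz by simp
  qed blast
  define f where "f u v = F (u, v)" for u v
  have f: "f (q y) (q z) = cobdry G p c y z" if "y \<in> carrier G" "z \<in> carrier G" for y z
    using F(2)[of "(y, z)"] that by (simp add: f_def)
  have fZ2: "f \<in> Z2 Q TQ p"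
  proof (rule Q.Z2I)
    have "F = (\<lambda>(u, v). f u v)" by (auto simp: f_def)
    then show "cont_fun (prod_topology TQ TQ) p (\<lambda>(u, v). f u v)" using F(1) by simp
    show "f u v = 0" if "u \<notin> carrier Q \<or> v \<notin> carrier Q" for u v
      using F(3)[of "(u, v)"] that by (auto simp: f_def)
    fix u v w assume "u \<in> carrier Q" "v \<in> carrier Q" "w \<in> carrier Q"
    then obtain g h k where "u = q g" "g \<in> carrier G" "v = q h" "h \<in> carrier G" "w = q k" "k \<in> carrier G"
      unfolding q_surj[symmetric] by (elim imageE)
    then show "int p dvd f v w - f (u \<otimes>\<^bsub>Q\<^esub> v) w + f u (v \<otimes>\<^bsub>Q\<^esub> w) - f u v"
      using Z2_cocycle[OF Z2_cobdry[OF c_cont], of g h k] f[of h k] f[of "g \<otimes> h" k] f[of g "h \<otimes> k"] f[of g h] by simp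
  qed
  have "compat f c"
    unfolding compat_def by (intro conjI ballI fZ2 c_cont) (simp add: f cobdry_eq dvd_mod_cancel)
  moreover have "\<not> int p dvd c x - c \<one>"
  proof
    assume B: "int p dvd c x - c \<one>"
    have "int p dvd c x - (\<theta> x + c \<one>)" using c_left[OF one_closed x(1)] Pc[OF x(1)] by simp
    from dvd_diff[OF B this] have "int p dvd \<theta> x - 0" by simp
    then show False using \<theta>x \<theta>_range[OF x(1)] eq_of_dvd_diff[of "int p" "\<theta> x" 0] by auto
  qed
  ultimately show thesis by (rule that)
qed

end

section \<open>Homomorphisms to the extra-special group\<close>

text \<open>Writing elements of \<open>M\<^bsub>p\<^sup>3\<^esub>\<close> as \<open>(f + p k, B)\<close> with \<open>f\<close> the residue of the first
  coordinate mod p, multiplicativity amounts to \<open>bock f - f \<union> B\<close> being the coboundary of \<open>f B - k\<close>.\<close>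
lemma Mp3_cochain_of_mult:
  fixes p :: int
  assumes "p \<noteq> 0" and "(f1 + p * k1) + (f2 + p * k2) * (1 + p * h1) = f3 + p * k3 + p\<^sup>2 * t"
    and pb: "p * b = f1 + f2 - f3" and "h1 + h2 = h3 + p * s"
  shows "p dvd b - f1 * h2 - ((f1 * h1 - k1) + (f2 * h2 - k2) - (f3 * h3 - k3))"
proof -
  \<comment> \<open>Cancelling p leaves an identity for the higher digits; b is the carry of the
    lower digits, that is, the value of the Bockstein cocycle, and s is the carry in the second
    coordinate.\<close>
  have "p * k3 = p * (b + k1 + k2 + f2 * h1 + p * k2 * h1 - p * t)"
    using assms(2) pb by (simp add: algebra_simps power2_eq_square)
  then have k3: "k3 = b + k1 + k2 + f2 * h1 + p * k2 * h1 - p * t" using assms(1) by (simp only: mult_cancel_left) simp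
  have f3: "f3 = f1 + f2 - p * b" and h3: "h3 = h1 + h2 - p * s" using assms(4) pb by simp_all
  have "b - f1 * h2 - ((f1 * h1 - k1) + (f2 * h2 - k2) - (f3 * h3 - k3)) =
      p * (t - k2 * h1 - b * (h1 + h2) - s * (f1 + f2) + p * b * s)"
    unfolding k3 f3 h3 by (simp add: algebra_simps)
  then show ?thesis by simp
qed

text \<open>The converse direction: the higher digit is recovered from the cochain as k = f h - c
  modulo p, and p k is then determined modulo p^2.\<close>

lemma Mp3_mult_of_cochain:
  fixes p :: int
  assumes pb: "p * b = f1 + f2 - f3" and h: "h1 + h2 = h3 + p * s"
    and k: "p dvd k1 - (f1 * h1 - c1)" "p dvd k2 - (f2 * h2 - c2)" "p dvd k3 - (f3 * h3 - c3)"
    and c: "p dvd b - f1 * h2 - (c1 + c2 - c3)"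
  shows "p\<^sup>2 dvd (f1 + p * k1) + (f2 + p * k2) * (1 + p * h1) - (f3 + p * k3)"
proof -
  obtain u1 u2 u3 w where u: "k1 - (f1 * h1 - c1) = p * u1" "k2 - (f2 * h2 - c2) = p * u2"
     "k3 - (f3 * h3 - c3) = p * u3" "b - f1 * h2 - (c1 + c2 - c3) = p * w" using k c by (elim dvdE)
  have f3: "f3 = f1 + f2 - p * b" and h3: "h3 = h1 + h2 - p * s" using h pb by simp_all
  have k123: "k1 = f1 * h1 - c1 + p * u1" "k2 = f2 * h2 - c2 + p * u2" "k3 = f3 * h3 - c3 + p * u3"
    and b: "b = f1 * h2 + (c1 + c2 - c3) + p * w"
    using u by linarith+
  have "b + k1 + k2 + f2 * h1 - k3 = p * (w + u1 + u2 - u3 + b * (h1 + h2) + s * (f1 + f2) - p * b * s)"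
    unfolding k123(1,2) k123(3)[unfolded f3 h3] by (subst (1) b) (simp add: algebra_simps)
  then obtain z where z: "b + k1 + k2 + f2 * h1 - k3 = p * z" by blast
  have "(f1 + p * k1) + (f2 + p * k2) * (1 + p * h1) - (f3 + p * k3) =
      p * (b + k1 + k2 + f2 * h1 - k3) + p\<^sup>2 * k2 * h1"
    unfolding f3 by (simp add: algebra_simps power2_eq_square)
  also have "\<dots> = p\<^sup>2 * (z + k2 * h1)" unfolding z by (simp add: algebra_simps power2_eq_square)
  finally show ?thesis by simp
qed

lemma Mp3_simps [simp]:
  "carrier (Mp3 p) = {0..<int p ^ 2} \<times> {0..<int p}"
  "(a, b) \<otimes>\<^bsub>Mp3 p\<^esub> (c, d) = ((a + c * (1 + int p * b)) mod int p ^ 2, (b + d) mod int p)"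
  "\<one>\<^bsub>Mp3 p\<^esub> = (0, 0)"
  by (simp_all add: Mp3_def)

lemma T_ofD: "x \<in> T_of G T U \<Longrightarrow> f \<in> hom G U \<Longrightarrow> continuous_map T (discrete_topology (carrier U)) f \<Longrightarrow> f x = \<one>\<^bsub>U\<^esub>"
  by (auto simp: T_of_def kernel_def)

lemma T_ofI:
  assumes "x \<in> carrier G"
    and "\<And>f. f \<in> hom G U \<Longrightarrow> continuous_map T (discrete_topology (carrier U)) f \<Longrightarrow> f x = \<one>\<^bsub>U\<^esub>"
  shows "x \<in> T_of G T U"
  using assms by (auto simp: T_of_def kernel_def)

abbreviation bock_cup :: "('g, 'b) monoid_scheme \<Rightarrow> nat \<Rightarrow> ('g \<Rightarrow> int) \<Rightarrow> ('g \<Rightarrow> int) \<Rightarrow> 'g \<Rightarrow> 'g \<Rightarrow> int" where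
  "bock_cup G p \<phi> \<psi> \<equiv> (\<lambda>x y. (bock G p \<phi> x y + cup G p \<phi> \<psi> x y) mod int p)"

section \<open>The cocycles Bock(\<phi>) + \<phi> \<union> \<psi>\<close>

context cochains begin

lemma H1D:
  assumes "\<phi> \<in> H1 G T p"
  shows "cont_fun T p \<phi>" "x \<notin> carrier G \<Longrightarrow> \<phi> x = 0"
    "x \<in> carrier G \<Longrightarrow> y \<in> carrier G \<Longrightarrow> \<phi> (x \<otimes> y) = (\<phi> x + \<phi> y) mod int p"
    "x \<in> carrier G \<Longrightarrow> \<phi> x \<in> {0..<int p}"
  using assms cont_fun_range[of \<phi> x] by (auto simp: H1_def)

lemma H1_dvd: "\<phi> \<in> H1 G T p \<Longrightarrow> x \<in> carrier G \<Longrightarrow> y \<in> carrier G \<Longrightarrow> int p dvd \<phi> x + \<phi> y - \<phi> (x \<otimes> y)"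
  by (simp add: H1D(3) dvd_mod_cancel)

lemma H1_one:
  assumes \<phi>: "\<phi> \<in> H1 G T p" shows "\<phi> \<one> = 0"
proof (rule eq_of_dvd_diff)
  show "int p dvd \<phi> \<one> - 0" using H1_dvd[OF \<phi> one_closed one_closed] by simp
qed (use H1D(4)[OF \<phi> one_closed] p_pos in auto)

text \<open>Exposes the exact integer carry b, so that later computations are integer identities
  free of \<open>div\<close> and \<open>mod\<close>.\<close>

lemma bock_cup_dvd:
  assumes "\<phi> \<in> H1 G T p" "x \<in> carrier G" "y \<in> carrier G"
  shows "\<exists>b. int p * b = \<phi> x + \<phi> y - \<phi> (x \<otimes> y) \<and> int p dvd bock_cup G p \<phi> \<psi> x y - (b + \<phi> x * \<psi> y)"
proof -
  obtain b where b: "\<phi> x + \<phi> y - \<phi> (x \<otimes> y) = int p * b" using H1_dvd[OF assms] by blast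
  have "bock_cup G p \<phi> \<psi> x y = (b mod int p + (\<phi> x * \<psi> y) mod int p) mod int p"
    using assms(2,3) p_pos by (simp add: bock_def cup_def b)
  then show ?thesis using b by (intro exI[of _ b]) (simp add: mod_eq_dvd_iff[symmetric] mod_simps)
qed

lemma bock_cup_Z2:
  assumes \<phi>: "\<phi> \<in> H1 G T p" and \<psi>: "\<psi> \<in> H1 G T p"
  shows "bock_cup G p \<phi> \<psi> \<in> Z2 G T p"
proof (rule Z2I)
  let ?D = "\<lambda>h. continuous_map (prod_topology T T) (discrete_topology UNIV) h"
  have c: "?D (\<lambda>z. \<phi> (fst z))" "?D (\<lambda>z. \<phi> (snd z))" "?D (\<lambda>z. \<psi> (snd z))" "?D (\<lambda>z. \<phi> (fst z \<otimes> snd z))"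
    using continuous_map_discrete_comp1[OF continuous_map_compose[OF continuous_map_fst[of T T] H1D(1)[OF \<phi>]], of "\<lambda>a. a" UNIV]
      continuous_map_discrete_comp1[OF continuous_map_compose[OF continuous_map_snd[of T T] H1D(1)[OF \<phi>]], of "\<lambda>a. a" UNIV]
      continuous_map_discrete_comp1[OF continuous_map_compose[OF continuous_map_snd[of T T] H1D(1)[OF \<psi>]], of "\<lambda>a. a" UNIV]
      continuous_map_discrete_comp1[OF continuous_map_compose[OF continuous_map_mult H1D(1)[OF \<phi>]], of "\<lambda>a. a" UNIV]
    by (simp_all add: o_def case_prod_beta)
  have c1: "?D (\<lambda>z. \<phi> (fst z) + \<phi> (snd z))"
    by (rule continuous_map_discrete_comp2[OF c(1,2), where F = "(+)"]) simp
  have c2: "?D (\<lambda>z. ((\<phi> (fst z) + \<phi> (snd z) - \<phi> (fst z \<otimes> snd z)) div int p) mod int p)"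
    by (rule continuous_map_discrete_comp2[OF c1 c(4), where F = "\<lambda>a b. ((a - b) div int p) mod int p"]) simp
  have c3: "?D (\<lambda>z. (\<phi> (fst z) * \<psi> (snd z)) mod int p)"
    by (rule continuous_map_discrete_comp2[OF c(1,3), where F = "\<lambda>a b. (a * b) mod int p"]) simp
  show "cont_fun (prod_topology T T) p (\<lambda>(x, y). bock_cup G p \<phi> \<psi> x y)"
    by (rule continuous_map_discrete_eq[OF continuous_map_discrete_comp2[OF c2 c3, where F = "\<lambda>a b. (a + b) mod int p"]])
      (use p_pos in \<open>auto simp: bock_def cup_def\<close>)
  show "bock_cup G p \<phi> \<psi> x y = 0" if "x \<notin> carrier G \<or> y \<notin> carrier G" for x y
    using that by (auto simp: bock_def cup_def)
  fix g h k assume ghk: "g \<in> carrier G" "h \<in> carrier G" "k \<in> carrier G"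
  then have gh: "g \<otimes> h \<in> carrier G" and hk: "h \<otimes> k \<in> carrier G" by auto
  obtain b1 where b1: "int p * b1 = \<phi> h + \<phi> k - \<phi> (h \<otimes> k)" "int p dvd bock_cup G p \<phi> \<psi> h k - (b1 + \<phi> h * \<psi> k)"
    using bock_cup_dvd[OF \<phi> ghk(2,3)] by blast
  obtain b2 where b2: "int p * b2 = \<phi> (g \<otimes> h) + \<phi> k - \<phi> (g \<otimes> h \<otimes> k)"
    "int p dvd bock_cup G p \<phi> \<psi> (g \<otimes> h) k - (b2 + \<phi> (g \<otimes> h) * \<psi> k)"
    using bock_cup_dvd[OF \<phi> gh ghk(3)] by blast
  obtain b3 where b3: "int p * b3 = \<phi> g + \<phi> (h \<otimes> k) - \<phi> (g \<otimes> (h \<otimes> k))"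
    "int p dvd bock_cup G p \<phi> \<psi> g (h \<otimes> k) - (b3 + \<phi> g * \<psi> (h \<otimes> k))"
    using bock_cup_dvd[OF \<phi> ghk(1) hk] by blast
  obtain b4 where b4: "int p * b4 = \<phi> g + \<phi> h - \<phi> (g \<otimes> h)" "int p dvd bock_cup G p \<phi> \<psi> g h - (b4 + \<phi> g * \<psi> h)"
    using bock_cup_dvd[OF \<phi> ghk(1,2)] by blast
  \<comment> \<open>Times p the carries telescope, by associativity; they therefore satisfy the
    cocycle identity exactly, before any reduction.\<close>
  have "int p * (b1 - b2 + b3 - b4) = 0"
    using b1(1) b2(1) b3(1) b4(1) ghk by (simp add: right_diff_distrib distrib_left m_assoc)
  then have b0: "b1 - b2 + b3 - b4 = 0" using p_pos by simp
  obtain s where s: "\<psi> h + \<psi> k - \<psi> (h \<otimes> k) = int p * s" using H1_dvd[OF \<psi> ghk(2,3)] by blast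
  \<comment> \<open>\<phi> and \<psi> are additive only up to p b4 and p s; these defects account
    for the right-hand side.\<close>
  have e: "\<phi> h * \<psi> k - \<phi> (g \<otimes> h) * \<psi> k + \<phi> g * \<psi> (h \<otimes> k) - \<phi> g * \<psi> h = int p * (b4 * \<psi> k - \<phi> g * s)"
  proof -
    have 1: "\<phi> (g \<otimes> h) = \<phi> g + \<phi> h - int p * b4" and 2: "\<psi> (h \<otimes> k) = \<psi> h + \<psi> k - int p * s" using b4(1) s by simp_all
    show ?thesis unfolding 1 2 by (simp add: algebra_simps)
  qed
  have "(b1 + \<phi> h * \<psi> k) - (b2 + \<phi> (g \<otimes> h) * \<psi> k) + (b3 + \<phi> g * \<psi> (h \<otimes> k)) - (b4 + \<phi> g * \<psi> h)
     = int p * (b4 * \<psi> k - \<phi> g * s)"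
    using b0 e by linarith
  then have "int p dvd (b1 + \<phi> h * \<psi> k) - (b2 + \<phi> (g \<otimes> h) * \<psi> k) + (b3 + \<phi> g * \<psi> (h \<otimes> k)) - (b4 + \<phi> g * \<psi> h)"
    by simp
  from dvd_add[OF this dvd_diff[OF dvd_add[OF dvd_diff[OF b1(2) b2(2)] b3(2)] b4(2)]]
  show "int p dvd bock_cup G p \<phi> \<psi> h k - bock_cup G p \<phi> \<psi> (g \<otimes> h) k + bock_cup G p \<phi> \<psi> g (h \<otimes> k) - bock_cup G p \<phi> \<psi> g h"
    by (rule back_subst[where P = "\<lambda>x. int p dvd x"]) linarith
qed

lemma trivial_hom_Mp3: "(\<lambda>x. (0, 0)) \<in> hom G (Mp3 p)"
  using p_pos by (auto simp: hom_def)

text \<open>The trivial homomorphism keeps the family of kernels nonempty; an empty intersection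
  would be the whole type.\<close>

lemma T_of_Mp3_carrier: "T_of G T (Mp3 p) \<subseteq> carrier G"
proof -
  have "continuous_map T (discrete_topology (carrier (Mp3 p))) (\<lambda>x. (0, 0))" using p_pos by simp
  then have "T_of G T (Mp3 p) \<subseteq> kernel G (Mp3 p) (\<lambda>x. (0, 0))"
    unfolding T_of_def using trivial_hom_Mp3 by blast
  then show ?thesis by (auto simp: kernel_def)
qed

text \<open>On pairs with second coordinate 0 the twist 1 + p b equals 1, so the powers of r form a
  copy of Z/p^2. The intersection in the theorem is thus the \<open>Mp3\<close> term alone.\<close>

lemma T_of_Mp3_subset_T_of_Zmod_p2: "T_of G T (Mp3 p) \<subseteq> T_of G T (Zmod_p2 p)"
proof
  fix x assume x: "x \<in> T_of G T (Mp3 p)"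
  have "f x = 0" if f: "f \<in> hom G (Zmod_p2 p)" "continuous_map T (discrete_topology (carrier (Zmod_p2 p))) f" for f
  proof -
    have hom: "(\<lambda>y. (f y, 0)) \<in> hom G (Mp3 p)"
      using f(1) p_pos by (auto simp: hom_def Zmod_p2_def Pi_iff)
    have cont: "continuous_map T (discrete_topology (carrier (Mp3 p))) (\<lambda>y. (f y, 0))"
    proof (rule continuous_map_discrete_comp1[OF f(2), where F = "\<lambda>a. (a, 0)"])
      show "(f y, 0) \<in> carrier (Mp3 p)" if "y \<in> topspace T" for y
        using continuous_map_discrete_range[OF f(2) that] p_pos by (simp add: Zmod_p2_def)
    qed
    from T_ofD[OF x hom cont] show ?thesis by simp
  qed
  moreover have "\<one>\<^bsub>Zmod_p2 p\<^esub> = 0" by (simp add: Zmod_p2_def)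
  ultimately show "x \<in> T_of G T (Zmod_p2 p)"
    using x T_of_Mp3_carrier by (intro T_ofI) auto
qed

end

section \<open>Functionals on \<Phi> coming from homomorphisms to \<open>Mp3\<close>\<close>

context frattini_quotient begin

text \<open>A point outside \<Phi> is detected by a continuous homomorphism \<theta> from G to Z/p,
  which becomes a homomorphism to \<open>Mp3\<close> through the powers of s.\<close>

lemma T_of_Mp3_subset_Phi: "T_of G T (Mp3 p) \<subseteq> \<Phi>"
proof
  fix x assume x: "x \<in> T_of G T (Mp3 p)"
  then have xc: "x \<in> carrier G" using T_of_Mp3_carrier by blast
  show "x \<in> \<Phi>"
  proof (rule ccontr)
    assume xP: "x \<notin> \<Phi>"
    obtain U \<theta> where U: "subgroup U G" "openin T U"
    and \<theta>_range: "\<And>v. v \<in> carrier G \<Longrightarrow> \<theta> v \<in> {0..<int p}"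
    and \<theta>_add: "\<And>v w. v \<in> carrier G \<Longrightarrow> w \<in> carrier G \<Longrightarrow> int p dvd \<theta> (v \<otimes> w) - (\<theta> v + \<theta> w)"
    and "\<And>w. w \<in> \<Phi> \<Longrightarrow> \<theta> w = 0"
    and \<theta>_U: "\<And>u. u \<in> U \<Longrightarrow> u \<in> carrier G \<Longrightarrow> \<theta> u = 0" and \<theta>x: "\<theta> x \<noteq> 0"
      by (rule ex_continuous_functional_nonzero[OF prime_p subgroup_self subgroup_lpc_two
          closedin_lpc_two subgroup.subset[OF subgroup_lpc_two] lpc_two_gens xc xP]) blast+
    have \<theta>_mult: "\<theta> (v \<otimes> w) = (\<theta> v + \<theta> w) mod int p" if "v \<in> carrier G" "w \<in> carrier G" for v w
      by (rule eq_mod_of_dvd[OF \<theta>_add[OF that] \<theta>_range]) (use that in simp)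
    have \<theta>_cont: "cont_fun T p \<theta>"
      unfolding continuous_map_discrete_iff
    proof (intro conjI ballI)
      show "\<theta> ` topspace T \<subseteq> {0..<int p}" using \<theta>_range by auto
      fix g assume "g \<in> topspace T"
      then have g: "g \<in> carrier G" by simp
      have "g \<in> (\<lambda>u. g \<otimes> u) ` U" using subgroup.one_closed[OF U(1)] g by (force simp: image_iff)
      moreover have "\<theta> (g \<otimes> u) = \<theta> g" if "u \<in> U" for u
        using \<theta>_mult[OF g] \<theta>_U that subgroup.mem_carrier[OF U(1) that] \<theta>_range[OF g] by simp
      ultimately show "\<exists>V. openin T V \<and> g \<in> V \<and> (\<forall>y\<in>V. \<theta> y = \<theta> g)"
        using openin_lmult[OF g U(2)] by (intro exI[of _ "(\<lambda>u. g \<otimes> u) ` U"]) simp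
    qed
    have cont: "continuous_map T (discrete_topology (carrier (Mp3 p))) (\<lambda>y. (0, \<theta> y))"
      by (rule continuous_map_discrete_comp1[OF \<theta>_cont, where F = "Pair 0"]) (use \<theta>_range p_pos in simp)
    have hom: "(\<lambda>y. (0, \<theta> y)) \<in> hom G (Mp3 p)"
      using \<theta>_range \<theta>_mult p_pos by (auto simp: hom_def)
    from T_ofD[OF x hom cont] show False using \<theta>x by simp
  qed
qed

text \<open>On \<Phi> the second coordinate and the lower digit of the first vanish, so \<rho>(a) =
  (p k(a), 0), and the functional of c = f B - k is -k there.\<close>

lemma compat_of_hom_Mp3:
  assumes \<rho>: "\<rho> \<in> hom G (Mp3 p)" "continuous_map T (discrete_topology (carrier (Mp3 p))) \<rho>"
  obtains \<phi> \<psi> c where "\<phi> \<in> H1 Q TQ p" "\<psi> \<in> H1 Q TQ p" "compat (bock_cup Q p \<phi> \<psi>) c"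
    "\<And>a. a \<in> \<Phi> \<Longrightarrow> \<rho> a = (0, 0) \<longleftrightarrow> int p dvd c a - c \<one>"
proof -
  define A B where "A x = fst (\<rho> x)" and "B x = snd (\<rho> x)" for x
  have range: "0 \<le> A x" "A x < int p ^ 2" "0 \<le> B x" "B x < int p" if "x \<in> carrier G" for x
  proof -
    have "\<rho> x \<in> carrier (Mp3 p)" by (rule continuous_map_discrete_range[OF \<rho>(2)]) (use that in simp)
    then show "0 \<le> A x" "A x < int p ^ 2" "0 \<le> B x" "B x < int p" by (simp_all add: A_def B_def mem_Times_iff)
  qed
  have A_mult: "A (x \<otimes> y) = (A x + A y * (1 + int p * B x)) mod int p ^ 2"
    and B_mult: "B (x \<otimes> y) = (B x + B y) mod int p" if "x \<in> carrier G" "y \<in> carrier G" for x y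
  proof -
    have "\<rho> (x \<otimes> y) = (A x, B x) \<otimes>\<^bsub>Mp3 p\<^esub> (A y, B y)"
      unfolding A_def B_def prod.collapse by (rule hom_mult[OF \<rho>(1) that])
    then have "\<rho> (x \<otimes> y) = ((A x + A y * (1 + int p * B x)) mod int p ^ 2, (B x + B y) mod int p)"
      unfolding Mp3_simps .
    then show "A (x \<otimes> y) = (A x + A y * (1 + int p * B x)) mod int p ^ 2" "B (x \<otimes> y) = (B x + B y) mod int p"
      unfolding A_def[of "x \<otimes> y"] B_def[of "x \<otimes> y"] by simp_all
  qed
  define f k where "f x = A x mod int p" and "k x = A x div int p" for x
  have A_eq: "A x = f x + int p * k x" for x by (simp add: f_def k_def)
  have f_range: "f x \<in> {0..<int p}" for x using p_pos by (simp add: f_def)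
  have B_cont: "cont_fun T p B"
    unfolding B_def by (rule continuous_map_discrete_comp1[OF \<rho>(2), where F = snd])
      (use range in \<open>simp add: B_def\<close>)
  have f_cont: "cont_fun T p f"
    unfolding f_def A_def by (rule continuous_map_discrete_comp1[OF \<rho>(2), where F = "\<lambda>z. fst z mod int p"])
      (use p_pos in simp)
  have k_cont: "continuous_map T (discrete_topology UNIV) k"
    unfolding k_def A_def by (rule continuous_map_discrete_comp1[OF \<rho>(2), where F = "\<lambda>z. fst z div int p"]) simp
  \<comment> \<open>Reduction modulo p^2 is traded for an explicit multiple of p^2, so that the
    digits can be compared as integers.\<close>
  have A_ex: "\<exists>t. (f x + int p * k x) + (f y + int p * k y) * (1 + int p * B x) = f (x \<otimes> y) + int p * k (x \<otimes> y) + (int p)\<^sup>2 * t"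
    if "x \<in> carrier G" "y \<in> carrier G" for x y
    using A_mult[OF that] mult_div_mod_eq[of "int p ^ 2" "A x + A y * (1 + int p * B x)"] unfolding A_eq[symmetric]
    by (intro exI[of _ "(A x + A y * (1 + int p * B x)) div int p ^ 2"]) simp
  have f_add: "int p dvd f (x \<otimes> y) - (f x + f y)" if xy: "x \<in> carrier G" "y \<in> carrier G" for x y
  proof -
    obtain t where "(f x + int p * k x) + (f y + int p * k y) * (1 + int p * B x) = f (x \<otimes> y) + int p * k (x \<otimes> y) + (int p)\<^sup>2 * t"
      using A_ex[OF xy] by blast
    then have "f (x \<otimes> y) - (f x + f y) = int p * (k x + k y + (f y + int p * k y) * B x - k (x \<otimes> y) - int p * t)"
      by (simp add: algebra_simps power2_eq_square)
    then show ?thesis by simp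
  qed
  have f_Phi: "f a = 0" if "a \<in> \<Phi>" for a
    by (rule hom_vanishes_on_lpc_two[OF f_cont f_add that])
  have B_Phi: "B a = 0" if "a \<in> \<Phi>" for a
    by (rule hom_vanishes_on_lpc_two[OF B_cont _ that]) (simp add: B_mult dvd_mod_cancel)
  have f_mult: "f (x \<otimes> y) = (f x + f y) mod int p" if "x \<in> carrier G" "y \<in> carrier G" for x y
    by (rule eq_mod_of_dvd[OF f_add[OF that] f_range])
  \<comment> \<open>The factor set of \<open>Mp3\<close> carries the cup product with a minus sign;
    negating B absorbs it into \<psi>.\<close>
  define B' where "B' x = (- B x) mod int p" for x
  have B'_cont: "cont_fun T p B'" unfolding B'_def by (rule cont_fun_mod1[OF B_cont, of uminus])
  have f_inv: "f (a \<otimes> x) = f x" if "a \<in> \<Phi>" "x \<in> carrier G" for a x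
    using f_mult[OF lpc_two_carrier[OF that(1)] that(2)] f_Phi[OF that(1)] f_range[of x] by simp
  have B'_inv: "B' (a \<otimes> x) = B' x" if "a \<in> \<Phi>" "x \<in> carrier G" for a x
    using B_mult[OF lpc_two_carrier[OF that(1)] that(2)] B_Phi[OF that(1)] by (simp add: B'_def mod_simps)
  obtain \<phi> where \<phi>: "cont_fun TQ p \<phi>" "\<forall>x\<in>carrier G. \<phi> (q x) = f x" "\<forall>u. u \<notin> carrier Q \<longrightarrow> \<phi> u = 0"
    by (rule cont_fun_descend[OF f_cont f_inv]) (simp_all add: that)
  obtain \<psi> where \<psi>: "cont_fun TQ p \<psi>" "\<forall>x\<in>carrier G. \<psi> (q x) = B' x" "\<forall>u. u \<notin> carrier Q \<longrightarrow> \<psi> u = 0"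
    by (rule cont_fun_descend[OF B'_cont B'_inv]) (simp_all add: that)
  have H1I: "d \<in> H1 Q TQ p" if "cont_fun TQ p d" "\<forall>x\<in>carrier G. d (q x) = e x" "\<forall>u. u \<notin> carrier Q \<longrightarrow> d u = 0"
    "\<And>x y. x \<in> carrier G \<Longrightarrow> y \<in> carrier G \<Longrightarrow> e (x \<otimes> y) = (e x + e y) mod int p" for d e
    unfolding H1_def
  proof (intro CollectI conjI ballI allI impI)
    fix u v assume "u \<in> carrier Q" "v \<in> carrier Q"
    then obtain x y where xy: "u = q x" "x \<in> carrier G" "v = q y" "y \<in> carrier G"
      unfolding q_surj[symmetric] by (elim imageE)
    then have "d (q (x \<otimes> y)) = (d (q x) + d (q y)) mod int p"
      using that(2) that(4)[OF xy(2,4)] by (metis m_closed)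
    then show "d (u \<otimes>\<^bsub>Q\<^esub> v) = (d u + d v) mod int p" using xy by simp
  qed (use that in auto)
  have \<phi>H: "\<phi> \<in> H1 Q TQ p" using \<phi> f_mult by (rule H1I)
  have \<psi>H: "\<psi> \<in> H1 Q TQ p"
  proof (rule H1I[OF \<psi>])
    fix x y assume "x \<in> carrier G" "y \<in> carrier G"
    then have "B' (x \<otimes> y) = (- (B x + B y)) mod int p" by (simp add: B'_def B_mult mod_minus_eq)
    also have "\<dots> = (B' x + B' y) mod int p" unfolding B'_def mod_add_eq by (simp add: algebra_simps)
    finally show "B' (x \<otimes> y) = (B' x + B' y) mod int p" .
  qed
  define c where "c x = (f x * B x - k x) mod int p" for x
  have c_dvd: "int p dvd c x - (f x * B x - k x)" for x by (simp add: c_def dvd_mod_cancel)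
  have c_cont: "cont_fun T p c"
  proof -
    have "continuous_map T (discrete_topology UNIV) (\<lambda>x. f x * B x)"
      by (rule continuous_map_discrete_comp2[OF f_cont B_cont, where F = "(*)"]) simp
    from continuous_map_discrete_comp2[OF this k_cont, where F = "\<lambda>a b. (a - b) mod int p" and D = "{0..<int p}"]
    show ?thesis unfolding c_def using p_pos by simp
  qed
  show thesis
  proof (rule that[OF \<phi>H \<psi>H])
    show "compat (bock_cup Q p \<phi> \<psi>) c"
      unfolding compat_def
    proof (intro conjI ballI)
      show "bock_cup Q p \<phi> \<psi> \<in> Z2 Q TQ p" by (rule Q.bock_cup_Z2[OF \<phi>H \<psi>H])
      fix x y assume xy: "x \<in> carrier G" "y \<in> carrier G"
      obtain b where "int p * b = \<phi> (q x) + \<phi> (q y) - \<phi> (q x \<otimes>\<^bsub>Q\<^esub> q y)"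
        and bc: "int p dvd bock_cup Q p \<phi> \<psi> (q x) (q y) - (b + \<phi> (q x) * \<psi> (q y))"
        using Q.bock_cup_dvd[OF \<phi>H, of "q x" "q y" \<psi>] xy by auto
      then have b: "int p * b = f x + f y - f (x \<otimes> y)"
        using \<phi>(2) xy by (metis m_closed q_mult)
      have bc': "int p dvd bock_cup Q p \<phi> \<psi> (q x) (q y) - (b + f x * B' y)"
        using bc \<phi>(2) \<psi>(2) xy by simp
      have B'y: "int p dvd B' y + B y" by (simp add: B'_def dvd_mod_cancel)
      obtain t where t: "(f x + int p * k x) + (f y + int p * k y) * (1 + int p * B x) = f (x \<otimes> y) + int p * k (x \<otimes> y) + (int p)\<^sup>2 * t"
        using A_ex[OF xy] by blast
      obtain s where s: "B x + B y = B (x \<otimes> y) + int p * s"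
        using B_mult[OF xy] mult_div_mod_eq[of "int p" "B x + B y"] by (metis add.commute)
      have "int p dvd b - f x * B y - ((f x * B x - k x) + (f y * B y - k y) - (f (x \<otimes> y) * B (x \<otimes> y) - k (x \<otimes> y)))"
        using Mp3_cochain_of_mult[OF _ t b s] p_pos by simp
      from dvd_add[OF dvd_diff[OF dvd_diff[OF dvd_add[OF dvd_add[OF this bc'] dvd_mult[OF B'y, of "f x"]] c_dvd[of x]] c_dvd[of y]] c_dvd[of "x \<otimes> y"]]
      show "int p dvd bock_cup Q p \<phi> \<psi> (q x) (q y) - (c x + c y - c (x \<otimes> y))"
        by (rule back_subst[where P = "\<lambda>x. int p dvd x"]) (simp add: algebra_simps)
    qed (fact c_cont)
    fix a assume a: "a \<in> \<Phi>"
    have one: "\<one> \<in> \<Phi>" by (rule subgroup.one_closed[OF subgroup_lpc_two])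
    have k1: "int p dvd k \<one>"
    proof -
      obtain t where "(f \<one> + int p * k \<one>) + (f \<one> + int p * k \<one>) * (1 + int p * B \<one>) = f \<one> + int p * k \<one> + (int p)\<^sup>2 * t"
        using A_ex[OF one_closed one_closed] by auto
      then have "int p * k \<one> = int p * (int p * t)" by (simp add: f_Phi[OF one] B_Phi[OF one] power2_eq_square algebra_simps)
      then show ?thesis using p_pos by simp
    qed
    \<comment> \<open>p k(a) is the first coordinate of \<rho>(a), hence below p^2. So k(a) is a
      residue, and divisibility by p means k(a) = 0.\<close>
    have k_range: "0 \<le> k a" "k a < int p"
    proof -
      note ra = range[OF lpc_two_carrier[OF a]]
      show "0 \<le> k a" using ra p_pos by (simp add: k_def pos_imp_zdiv_nonneg_iff)
      have "int p * k a < int p * int p" using ra A_eq[of a] f_Phi[OF a] by (simp add: power2_eq_square)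
      then show "k a < int p" using p_pos by simp
    qed
    have "\<rho> a = (0, 0) \<longleftrightarrow> k a = 0"
      using A_eq[of a] f_Phi[OF a] B_Phi[OF a] p_pos by (simp add: prod_eq_iff A_def B_def)
    also have "\<dots> \<longleftrightarrow> int p dvd k a"
      using eq_of_dvd_diff[of "int p" "k a" 0] k_range by auto
    also have "\<dots> \<longleftrightarrow> int p dvd c a - c \<one>"
    proof -
      have "int p dvd c a + k a" "int p dvd c \<one> + k \<one>"
        using c_dvd[of a] c_dvd[of \<one>] f_Phi[OF a] f_Phi[OF one] by simp_all
      then show ?thesis
        using k1 by (metis add_diff_cancel_left' diff_0_right dvd_add_right_iff dvd_diff_right_iff dvd_add_left_iff diff_conv_add_uminus dvd_minus_iff)
    qed
    finally show "\<rho> a = (0, 0) \<longleftrightarrow> int p dvd c a - c \<one>" .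
  qed
qed

text \<open>A witness c for Bock(\<phi>) + \<phi> \<union> \<psi> solves an embedding problem: it
  lifts the homomorphism (\<phi>, -\<psi>) from G to (Z/p)^2 to some \<rho> into \<open>Mp3\<close>.
  As \<rho> kills x, the functional of c does.\<close>

lemma T_of_Mp3_compat:
  assumes x: "x \<in> T_of G T (Mp3 p)" and \<phi>: "\<phi> \<in> H1 Q TQ p" and \<psi>: "\<psi> \<in> H1 Q TQ p"
    and c: "compat (bock_cup Q p \<phi> \<psi>) c"
  shows "int p dvd c x - c \<one>"
proof -
  have xP: "x \<in> \<Phi>" using x T_of_Mp3_subset_Phi by blast
  have xc: "x \<in> carrier G" "q x = \<one>\<^bsub>Q\<^esub>" using xP by (auto simp: mem_Phi_iff)
  \<comment> \<open>k solves c = f B - k, the relation between cochain and higher digit, now read in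
    the other direction.\<close>
  define f B k where "f y = \<phi> (q y)" and "B y = (- \<psi> (q y)) mod int p" and "k y = (f y * B y - c y) mod int p" for y
  define \<rho> where "\<rho> y = (f y + int p * k y, B y)" for y
  note c_cont = compatD(2)[OF c]
  have f_cont: "cont_fun T p f" unfolding f_def by (rule cont_fun_q[OF Q.H1D(1)[OF \<phi>]])
  have B_cont: "cont_fun T p B" unfolding B_def by (rule cont_fun_mod1[OF cont_fun_q[OF Q.H1D(1)[OF \<psi>]], of uminus])
  have k_cont: "cont_fun T p k"
  proof -
    have "continuous_map T (discrete_topology UNIV) (\<lambda>x. f x * B x)"
      by (rule continuous_map_discrete_comp2[OF f_cont B_cont, where F = "(*)"]) simp
    from continuous_map_discrete_comp2[OF this c_cont, where F = "\<lambda>a b. (a - b) mod int p" and D = "{0..<int p}"]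
    show ?thesis unfolding k_def using p_pos by simp
  qed
  have A_range: "f y + int p * k y \<in> {0..<int p ^ 2}" if "y \<in> carrier G" for y
  proof -
    have "f y \<in> {0..<int p}" "k y \<in> {0..<int p}" using cont_fun_range[OF f_cont that] cont_fun_range[OF k_cont that] .
    then have "int p * k y \<le> int p * (int p - 1)" "0 \<le> int p * k y" "f y < int p" "0 \<le> f y" by (auto intro!: mult_left_mono)
    then show ?thesis by (simp add: power2_eq_square algebra_simps)
  qed
  have "continuous_map T (discrete_topology (carrier (Mp3 p))) \<rho>"
  proof -
    have "continuous_map T (discrete_topology {0..<int p ^ 2}) (\<lambda>y. f y + int p * k y)"
      by (rule continuous_map_discrete_comp2[OF f_cont k_cont, where F = "\<lambda>a b. a + int p * b"]) (use A_range in simp)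
    from continuous_map_discrete_comp2[OF this B_cont, where F = Pair and D = "carrier (Mp3 p)"]
    show ?thesis unfolding \<rho>_def using A_range cont_fun_range[OF B_cont] by simp
  qed
  moreover have "\<rho> \<in> hom G (Mp3 p)"
    unfolding hom_def
  proof (intro CollectI conjI ballI funcsetI)
    show "\<rho> y \<in> carrier (Mp3 p)" if "y \<in> carrier G" for y
      using that A_range cont_fun_range[OF B_cont that] by (simp add: \<rho>_def)
    fix y z assume yz: "y \<in> carrier G" "z \<in> carrier G"
    obtain b where b: "int p * b = f y + f z - f (y \<otimes> z)"
      and bc: "int p dvd bock_cup Q p \<phi> \<psi> (q y) (q z) - (b + f y * \<psi> (q z))"
      using Q.bock_cup_dvd[OF \<phi>, of "q y" "q z" \<psi>] yz by (auto simp: f_def)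
    have B_eq: "int p dvd B w + \<psi> (q w)" for w by (simp add: B_def dvd_mod_cancel)
    have Bdvd: "int p dvd B y + B z - B (y \<otimes> z)"
      using dvd_diff[OF dvd_diff[OF dvd_add[OF B_eq[of y] B_eq[of z]] B_eq[of "y \<otimes> z"]] Q.H1_dvd[OF \<psi>, of "q y" "q z"]] yz
      by (simp add: algebra_simps)
    have B_mult: "B (y \<otimes> z) = (B y + B z) mod int p"
      using Bdvd cont_fun_range[OF B_cont, of "y \<otimes> z"] yz
      by (intro eq_mod_of_dvd) (simp_all add: dvd_diff_commute)
    obtain s where "B y + B z - B (y \<otimes> z) = int p * s" using Bdvd by blast
    then have s: "B y + B z = B (y \<otimes> z) + int p * s" by simp
    have k_dvd: "int p dvd k w - (f w * B w - c w)" for w by (simp add: k_def dvd_mod_cancel)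
    have "int p dvd b - f y * B z - (c y + c z - c (y \<otimes> z))"
      using dvd_diff[OF dvd_diff[OF compatD(3)[OF c yz] bc] dvd_mult[OF B_eq[of z], of "f y"]]
      by (rule back_subst[where P = "\<lambda>x. int p dvd x"]) (simp add: algebra_simps)
    from Mp3_mult_of_cochain[OF b s k_dvd k_dvd k_dvd this]
    have "f (y \<otimes> z) + int p * k (y \<otimes> z) = (f y + int p * k y + (f z + int p * k z) * (1 + int p * B y)) mod int p ^ 2"
      using A_range[of "y \<otimes> z"] yz by (intro eq_mod_of_dvd) (simp_all add: dvd_diff_commute)
    then show "\<rho> (y \<otimes> z) = \<rho> y \<otimes>\<^bsub>Mp3 p\<^esub> \<rho> z" using B_mult by (simp add: \<rho>_def)
  qed
  ultimately have "\<rho> x = \<one>\<^bsub>Mp3 p\<^esub>" using T_ofD[OF x] by blast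
  moreover have "f x = 0" "B x = 0" using xc Q.H1_one[OF \<phi>] Q.H1_one[OF \<psi>] by (simp_all add: f_def B_def)
  ultimately have "k x = 0" using p_pos by (simp add: \<rho>_def)
  then have "int p dvd c x" using \<open>f x = 0\<close> by (simp add: k_def mod_eq_0_iff_dvd)
  \<comment> \<open>Bock(\<phi>) + \<phi> \<union> \<psi> vanishes at (1, 1) because \<phi>(1) = 0,
    so c(1) is 0 modulo p.\<close>
  moreover have "int p dvd c \<one>"
  proof -
    have "bock_cup Q p \<phi> \<psi> \<one>\<^bsub>Q\<^esub> \<one>\<^bsub>Q\<^esub> = 0" using Q.H1_one[OF \<phi>] by (simp add: bock_def cup_def)
    then show ?thesis using compat_one(1)[OF c Q.one_closed] by simp
  qed
  ultimately show ?thesis by (rule dvd_diff)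
qed

lemma lpc_three_subset_T_of_Mp3: "lpc G T p 3 \<subseteq> T_of G T (Mp3 p)"
proof
  fix x assume x: "x \<in> lpc G T p 3"
  then have xP: "x \<in> \<Phi>" using lpc_three_subset by blast
  have "\<rho> x = (0, 0)" if \<rho>: "\<rho> \<in> hom G (Mp3 p)" "continuous_map T (discrete_topology (carrier (Mp3 p))) \<rho>" for \<rho>
  proof -
    obtain \<phi> \<psi> c where "compat (bock_cup Q p \<phi> \<psi>) c" and \<rho>c: "\<forall>a\<in>\<Phi>. \<rho> a = (0, 0) \<longleftrightarrow> int p dvd c a - c \<one>"
      by (rule compat_of_hom_Mp3[OF \<rho>]) (simp_all add: that)
    from compat_vanishes_on_lpc_three[OF this(1) x] \<rho>c xP show ?thesis by simp
  qed
  then show "x \<in> T_of G T (Mp3 p)" using lpc_two_carrier[OF xP] by (intro T_ofI) simp_all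
qed

section \<open>Duality\<close>

text \<open>This is the annihilator of Y for the pairing of \<Phi> with the kernel of inflation. An
  empty Y gives the whole kernel, a singleton the classes that kill one point.\<close>

lemma subgroup_compat_vanishing:
  assumes Y: "Y \<subseteq> \<Phi>"
  shows "subgroup {cls Q TQ p f | f. \<exists>c. compat f c \<and> (\<forall>x\<in>Y. int p dvd c x - c \<one>)} (H2 Q TQ p)" (is "subgroup ?L _")
proof (rule Q.H.subgroupI)
  show "?L \<subseteq> carrier (H2 Q TQ p)" using compatD(1) by (auto simp: Q.carrier_H2)
  have "compat (\<lambda>u v. 0) (\<lambda>x. 0)" using Q.Z2_zero p_pos by (simp add: compat_def)
  moreover have "\<forall>x\<in>Y. int p dvd (\<lambda>x. 0) x - (\<lambda>x. 0) \<one>" by simp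
  ultimately show "?L \<noteq> {}" by blast
  fix C assume "C \<in> ?L"
  then obtain f c where f: "C = cls Q TQ p f" "compat f c" "\<forall>x\<in>Y. int p dvd c x - c \<one>" by blast
  have "\<forall>x\<in>Y. int p dvd (- c x) mod int p - (- c \<one>) mod int p"
    using f(3) by (simp add: dvd_mod_cancel dvd_diff_commute)
  then show "inv\<^bsub>H2 Q TQ p\<^esub> C \<in> ?L"
    using compat_uminus[OF f(2)] unfolding f(1) Q.cls_inv[OF compatD(1)[OF f(2)]] by blast
  fix D assume "D \<in> ?L"
  then obtain g d where g: "D = cls Q TQ p g" "compat g d" "\<forall>x\<in>Y. int p dvd d x - d \<one>" by blast
  have "int p dvd (c x + d x) mod int p - (c \<one> + d \<one>) mod int p" if "x \<in> Y" for x
    using dvd_add[OF bspec[OF f(3) that] bspec[OF g(3) that]] by (simp add: dvd_mod_cancel algebra_simps)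
  then show "C \<otimes>\<^bsub>H2 Q TQ p\<^esub> D \<in> ?L"
    using compat_add[OF f(2) g(2)] unfolding f(1) g(1) Q.cls_mult[OF compatD(1)[OF f(2)] compatD(1)[OF g(2)]] by blast
qed

abbreviation K where "K \<equiv> kernel (H2 Q TQ p) (H2 G T p) (infl Q G T p q)"

abbreviation BC where "BC \<equiv> {cls Q TQ p (bock_cup Q p \<phi> \<psi>) | \<phi> \<psi>. \<phi> \<in> H1 Q TQ p \<and> \<psi> \<in> H1 Q TQ p}"

lemma subgroup_K: "subgroup K (H2 Q TQ p)"
proof -
  have "K = {cls Q TQ p f | f. \<exists>c. compat f c \<and> (\<forall>x\<in>{}. int p dvd c x - c \<one>)}"
    using mem_kernel_infl_iff by blast
  then show ?thesis using subgroup_compat_vanishing[of "{}"] by simp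
qed

text \<open>A point x of T is killed by every class in \<open>K \<inter> BC\<close>, hence by the
  subgroup they generate, which is all of \<open>K\<close>. But a point of \<Phi> outside G^(3,p) is
  detected by some class in \<open>K\<close>.\<close>

lemma T_of_subset_if_generated:
  assumes gen: "K \<subseteq> generate (H2 Q TQ p) (K \<inter> BC)"
  shows "T_of G T (Mp3 p) \<subseteq> lpc G T p 3"
proof
  fix x assume x: "x \<in> T_of G T (Mp3 p)"
  then have xP: "x \<in> \<Phi>" using T_of_Mp3_subset_Phi by blast
  let ?L = "{cls Q TQ p f | f. \<exists>c. compat f c \<and> (\<forall>y\<in>{x}. int p dvd c y - c \<one>)}"
  have "K \<inter> BC \<subseteq> ?L"
  proof
    fix C assume C: "C \<in> K \<inter> BC"
    then obtain \<phi> \<psi> where \<phi>\<psi>: "\<phi> \<in> H1 Q TQ p" "\<psi> \<in> H1 Q TQ p" "C = cls Q TQ p (bock_cup Q p \<phi> \<psi>)" by blast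
    obtain f c where fc: "compat f c" "C = cls Q TQ p f" using C mem_kernel_infl_iff by blast
    have "bock_cup Q p \<phi> \<psi> \<in> cls Q TQ p f"
      using Q.cls_self[OF Q.bock_cup_Z2[OF \<phi>\<psi>(1,2)]] \<phi>\<psi>(3) fc(2) by simp
    then obtain c' where c': "compat (bock_cup Q p \<phi> \<psi>) c'" by (rule compat_cls[OF fc(1)])
    have "\<forall>y\<in>{x}. int p dvd c' y - c' \<one>" using T_of_Mp3_compat[OF x \<phi>\<psi>(1,2) c'] by simp
    then show "C \<in> ?L" using c' \<phi>\<psi>(3) by blast
  qed
  then have "generate (H2 Q TQ p) (K \<inter> BC) \<subseteq> ?L"
    by (rule Q.H.generate_subgroup_incl) (use subgroup_compat_vanishing[of "{x}"] xP in simp)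
  with gen have KL: "K \<subseteq> ?L" by blast
  show "x \<in> lpc G T p 3"
  proof (rule ccontr)
    assume "x \<notin> lpc G T p 3"
    then obtain f c where fc: "compat f c" "\<not> int p dvd c x - c \<one>" using ex_compat_nonzero[OF xP] by blast
    then have "cls Q TQ p f \<in> ?L" using KL mem_kernel_infl_iff by blast
    then obtain g d where g: "cls Q TQ p f = cls Q TQ p g" "compat g d" "int p dvd d x - d \<one>" by blast
    \<comment> \<open>The class of f kills x through some other representative g. Returning to f may
      change the cochain, but by \<open>compat_unique\<close> not its functional on \<Phi>.\<close>
    have fg: "f \<in> cls Q TQ p g" using Q.cls_self[OF compatD(1)[OF fc(1)]] g(1) by simp
    obtain d' where d': "compat f d'" and d'_eq: "\<forall>a\<in>\<Phi>. int p dvd (d' a - d' \<one>) - (d a - d \<one>)"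
      by (rule compat_cls[OF g(2) fg]) (simp_all add: that)
    from dvd_add[OF dvd_add[OF compat_unique[OF fc(1) d' xP] bspec[OF d'_eq xP]] g(3)]
    have "int p dvd c x - c \<one>" by simp
    with fc(2) show False by blast
  qed
qed

text \<open>Compactness confines the comparison to finitely many functionals, linear algebra writes
  the functional of C in terms of them, and injectivity of the transgression turns this into an
  equality of classes.\<close>

lemma generated_if_T_of_subset:
  assumes T: "T_of G T (Mp3 p) \<subseteq> lpc G T p 3"
  shows "K \<subseteq> generate (H2 Q TQ p) (K \<inter> BC)"
proof
  fix C assume "C \<in> K"
  then obtain f c where fc: "compat f c" and C: "C = cls Q TQ p f" using mem_kernel_infl_iff by blast
  let ?gen = "generate (H2 Q TQ p) (K \<inter> BC)"
  have gen: "subgroup ?gen (H2 Q TQ p)"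
    by (rule Q.H.generate_is_subgroup) (use subgroup.subset[OF subgroup_K] in blast)
  define E where "E = {c'. \<exists>\<phi>\<in>H1 Q TQ p. \<exists>\<psi>\<in>H1 Q TQ p. compat (bock_cup Q p \<phi> \<psi>) c'}"
  have E_cont: "cont_fun T p c'" if "c' \<in> E" for c' using that compatD(2) by (auto simp: E_def)
  \<comment> \<open>Z is the compact part of \<Phi> where the functional of f is nonzero. Its points
    lie outside G^(3,p), hence outside T, so each is detected by a homomorphism to
    \<open>Mp3\<close> and thereby by a member of E.\<close>
  define Z where "Z = \<Phi> \<inter> {x \<in> topspace T. \<not> int p dvd c x - c \<one>}"
  have "closedin T Z" unfolding Z_def
    by (intro closedin_Int closedin_lpc_two closedin_discrete_vimage[OF compatD(2)[OF fc]])
  then have Z: "compactin T Z" using compact_space closedin_compact_space by blast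
  define O' where "O' c' = {x \<in> topspace T. \<not> int p dvd c' x - c' \<one>}" for c' :: "'g \<Rightarrow> int"
  have "openin T (O' c')" if "c' \<in> E" for c'
    unfolding O'_def by (rule openin_discrete_vimage[OF E_cont[OF that]])
  moreover have "Z \<subseteq> \<Union> (O' ` E)"
  proof
    fix x assume "x \<in> Z"
    then have x: "x \<in> \<Phi>" "x \<in> carrier G" "\<not> int p dvd c x - c \<one>" by (auto simp: Z_def)
    then have "x \<notin> T_of G T (Mp3 p)" using T compat_vanishes_on_lpc_three[OF fc] by blast
    then obtain \<rho> where \<rho>: "\<rho> \<in> hom G (Mp3 p)" "continuous_map T (discrete_topology (carrier (Mp3 p))) \<rho>"
      and \<rho>x: "\<rho> x \<noteq> \<one>\<^bsub>Mp3 p\<^esub>" using T_ofI[OF x(2)] by metis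
    obtain \<phi> \<psi> c' where c': "\<phi> \<in> H1 Q TQ p" "\<psi> \<in> H1 Q TQ p" "compat (bock_cup Q p \<phi> \<psi>) c'"
      and "\<forall>a\<in>\<Phi>. \<rho> a = (0, 0) \<longleftrightarrow> int p dvd c' a - c' \<one>"
      by (rule compat_of_hom_Mp3[OF \<rho>]) (simp_all add: that)
    then have "\<not> int p dvd c' x - c' \<one>" using \<rho>x x(1) by simp
    then have "x \<in> O' c'" using x(2) by (simp add: O'_def)
    moreover have "c' \<in> E" unfolding E_def using c' by blast
    ultimately show "x \<in> \<Union> (O' ` E)" by blast
  qed
  ultimately obtain \<F> where \<F>: "finite \<F>" "\<F> \<subseteq> O' ` E" "Z \<subseteq> \<Union>\<F>"
    using compactinD[OF Z, of "O' ` E"] by blast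
  then obtain F where F: "finite F" "F \<subseteq> E" "Z \<subseteq> \<Union> (O' ` F)"
    using finite_subset_image[OF \<F>(1,2)] by blast
  \<comment> \<open>Membership is only up to congruence on \<Phi>, so that plain integer sums stay
    in L while the cochains d are reduced modulo p.\<close>
  define L where "L = {l. \<exists>g d. compat g d \<and> cls Q TQ p g \<in> ?gen \<and> (\<forall>x\<in>\<Phi>. int p dvd l x - (d x - d \<one>))}"
  have L0: "(\<lambda>x. 0) \<in> L"
  proof -
    have "compat (\<lambda>u v. 0) (\<lambda>x. 0)" using Q.Z2_zero p_pos by (simp add: compat_def)
    moreover have "cls Q TQ p (\<lambda>u v. 0) \<in> ?gen"
    proof -
      have "(\<lambda>u v. 0) \<in> B2 Q TQ p" using subgroup.one_closed[OF Q.subgroup_B2] by simp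
      then show ?thesis using Q.cls_eq_one_iff[OF Q.Z2_zero] subgroup.one_closed[OF gen] by simp
    qed
    ultimately show ?thesis unfolding L_def by (intro CollectI exI conjI) auto
  qed
  have Ladd: "(\<lambda>x. l x + m x) \<in> L" if lm: "l \<in> L" "m \<in> L" for l m
  proof -
    obtain g d where g: "compat g d" "cls Q TQ p g \<in> ?gen" "\<forall>x\<in>\<Phi>. int p dvd l x - (d x - d \<one>)"
      using lm(1) by (auto simp: L_def)
    obtain h e where h: "compat h e" "cls Q TQ p h \<in> ?gen" "\<forall>x\<in>\<Phi>. int p dvd m x - (e x - e \<one>)"
      using lm(2) by (auto simp: L_def)
    have "cls Q TQ p (\<lambda>u v. (g u v + h u v) mod int p) \<in> ?gen"
      using subgroup.m_closed[OF gen g(2) h(2)] Q.cls_mult[OF compatD(1)[OF g(1)] compatD(1)[OF h(1)]] by simp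
    moreover have "int p dvd (l x + m x) - ((d x + e x) mod int p - (d \<one> + e \<one>) mod int p)" if "x \<in> \<Phi>" for x
    proof -
      have cc: "int p dvd (a::int) mod int p - a" for a by (simp add: dvd_mod_cancel)
      from dvd_add[OF dvd_diff[OF dvd_add[OF bspec[OF g(3) that] bspec[OF h(3) that]] cc[of "d x + e x"]] cc[of "d \<one> + e \<one>"]]
      show ?thesis by (rule back_subst[where P = "\<lambda>x. int p dvd x"]) simp
    qed
    ultimately show ?thesis unfolding L_def using compat_add[OF g(1) h(1)] by blast
  qed
  have hom: "int p dvd (d (x \<otimes> y) - d \<one>) - ((d x - d \<one>) + (d y - d \<one>))" if "compat g d" "x \<in> \<Phi>" "y \<in> \<Phi>" for g d x y
    using compat_Phi(1)[OF that(1,2) lpc_two_carrier[OF that(3)]] by (simp add: algebra_simps)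
  have Lhom: "int p dvd l (x \<otimes> y) - (l x + l y)" if "l \<in> L" "x \<in> \<Phi>" "y \<in> \<Phi>" for l x y
  proof -
    obtain g d where g: "compat g d" "\<forall>x\<in>\<Phi>. int p dvd l x - (d x - d \<one>)"
      using \<open>l \<in> L\<close> by (auto simp: L_def)
    from dvd_diff[OF dvd_diff[OF dvd_add[OF hom[OF g(1) that(2,3)] bspec[OF g(2) subgroup.m_closed[OF subgroup_lpc_two that(2,3)]]]
      bspec[OF g(2) that(2)]] bspec[OF g(2) that(3)]]
    show ?thesis by (rule back_subst[where P = "\<lambda>x. int p dvd x"]) simp
  qed
  define F' where "F' = (\<lambda>c' x. c' x - c' \<one>) ` F"
  have "F' \<subseteq> L"
  proof
    fix l assume "l \<in> F'"
    then obtain c' where c': "c' \<in> E" "l = (\<lambda>x. c' x - c' \<one>)" using F(2) by (auto simp: F'_def)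
    then obtain \<phi> \<psi> where \<phi>\<psi>: "\<phi> \<in> H1 Q TQ p" "\<psi> \<in> H1 Q TQ p" "compat (bock_cup Q p \<phi> \<psi>) c'" by (auto simp: E_def)
    then have "cls Q TQ p (bock_cup Q p \<phi> \<psi>) \<in> K \<inter> BC" using mem_kernel_infl_iff by blast
    then have "cls Q TQ p (bock_cup Q p \<phi> \<psi>) \<in> ?gen" by (rule generate.incl)
    moreover have "\<forall>x\<in>\<Phi>. int p dvd l x - (c' x - c' \<one>)" by (simp add: c'(2))
    ultimately show "l \<in> L" unfolding L_def using \<phi>\<psi>(3) by blast
  qed
  moreover have "finite F'" using F(1) by (simp add: F'_def)
  \<comment> \<open>The finite cover read contrapositively: where all functionals from F vanish, x
    lies outside Z.\<close>
  moreover have "int p dvd c x - c \<one>" if x: "x \<in> \<Phi>" and 0: "\<And>l. l \<in> F' \<Longrightarrow> int p dvd l x" for x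
  proof (rule ccontr)
    assume "\<not> int p dvd c x - c \<one>"
    then have "x \<in> Z" using x lpc_two_carrier[OF x] by (simp add: Z_def)
    then obtain c' where "c' \<in> F" "x \<in> O' c'" using F(3) by blast
    then show False using 0[of "\<lambda>x. c' x - c' \<one>"] by (auto simp: O'_def F'_def)
  qed
  ultimately obtain l where l: "l \<in> L" "\<And>x. x \<in> \<Phi> \<Longrightarrow> int p dvd (c x - c \<one>) - l x"
    using functional_in_span[OF prime_p subgroup_lpc_two L0 Ladd Lhom hom[OF fc] _ _ subgroup_lpc_two order_refl, of F'] by blast
  obtain g d where g: "compat g d" "cls Q TQ p g \<in> ?gen" "\<forall>x\<in>\<Phi>. int p dvd l x - (d x - d \<one>)"
    using l(1) by (auto simp: L_def)
  \<comment> \<open>The cocycle f - g has zero functional on \<Phi>, hence is a coboundary.\<close>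
  let ?h = "\<lambda>u v. (f u v + (- g u v) mod int p) mod int p"
  have h: "compat ?h (\<lambda>x. (c x + (- d x) mod int p) mod int p)"
    by (rule compat_add[OF fc compat_uminus[OF g(1)]])
  have "?h \<in> B2 Q TQ p"
  proof (rule compat_trivial[OF h])
    fix a assume a: "a \<in> \<Phi>"
    have "int p dvd (c a + - d a) - (c \<one> + - d \<one>)"
      using dvd_add[OF l(2)[OF a] bspec[OF g(3) a]] by (simp add: algebra_simps)
    then show "int p dvd (c a + (- d a) mod int p) mod int p - (c \<one> + (- d \<one>) mod int p) mod int p"
      unfolding mod_add_right_eq dvd_mod_cancel .
  qed
  then have "cls Q TQ p ?h = \<one>\<^bsub>H2 Q TQ p\<^esub>" using Q.cls_eq_one_iff[OF compatD(1)[OF h]] by blast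
  moreover have "cls Q TQ p ?h = C \<otimes>\<^bsub>H2 Q TQ p\<^esub> inv\<^bsub>H2 Q TQ p\<^esub> cls Q TQ p g"
    unfolding C Q.cls_inv[OF compatD(1)[OF g(1)]]
    by (rule Q.cls_mult[symmetric]) (use compatD(1)[OF fc] Q.Z2_uminus compatD(1)[OF g(1)] in auto)
  ultimately have "C \<otimes>\<^bsub>H2 Q TQ p\<^esub> inv\<^bsub>H2 Q TQ p\<^esub> cls Q TQ p g = \<one>\<^bsub>H2 Q TQ p\<^esub>" by simp
  moreover have "C \<in> carrier (H2 Q TQ p)" "cls Q TQ p g \<in> carrier (H2 Q TQ p)"
    using compatD(1)[OF fc] compatD(1)[OF g(1)] by (auto simp: C Q.carrier_H2)
  ultimately have "C = cls Q TQ p g" using Q.H.inv_equality Q.H.inv_inv Q.H.inv_closed by metis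
  then show "C \<in> ?gen" using g(2) by simp
qed

text \<open>In both equalities one inclusion always holds: G^(3,p) lies in the two T-subgroups, and
  classes taken from the subgroup \<open>K\<close> generate a subgroup of \<open>K\<close>. The two
  remaining inclusions are equivalent by duality.\<close>

lemma T_of_eq_iff_bock_cup_kernel_condition:
  "T_of G T (Zmod_p2 p) \<inter> T_of G T (Mp3 p) = lpc G T p 3 \<longleftrightarrow> bock_cup_kernel_condition Q TQ G T p q"
proof -
  have "T_of G T (Zmod_p2 p) \<inter> T_of G T (Mp3 p) = lpc G T p 3 \<longleftrightarrow> T_of G T (Mp3 p) \<subseteq> lpc G T p 3"
    using T_of_Mp3_subset_T_of_Zmod_p2 lpc_three_subset_T_of_Mp3 by blast
  also have "\<dots> \<longleftrightarrow> K \<subseteq> generate (H2 Q TQ p) (K \<inter> BC)"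
    using T_of_subset_if_generated generated_if_T_of_subset by blast
  also have "\<dots> \<longleftrightarrow> K = generate (H2 Q TQ p) (K \<inter> BC)"
    using Q.H.generate_subgroup_incl[OF Int_lower1 subgroup_K, of BC] by blast
  finally show ?thesis unfolding bock_cup_kernel_condition_def Let_def .
qed

end

theorem theorem11p4:
  fixes S :: "'s monoid" and TS :: "'s topology" and A :: "'x set" and \<iota> :: "'x \<Rightarrow> 's"
    and N :: "'s set"
    and G :: "'g monoid" and TG :: "'g topology" and \<pi> :: "'s \<Rightarrow> 'g"
    and Q :: "'h monoid" and TQ :: "'h topology" and q :: "'g \<Rightarrow> 'h"
    and p :: nat
  assumes "Factorial_Ring.prime p" and "p > 2"
    and "free_profinite S TS A \<iota>"
    and "closedin TS N" and "N \<lhd> S" and "N \<subseteq> lpc S TS p 2"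
    \<comment> \<open>G = S/N: G profinite, \<pi> continuous surjective homomorphism with kernel N\<close>
    and "profinite_group G TG" and "\<pi> \<in> hom S G" and "continuous_map TS TG \<pi>"
    and "\<pi> ` carrier S = carrier G" and "kernel S G \<pi> = N"
    \<comment> \<open>Q = G/G^{(2,p)}: Q profinite, q continuous surjective homomorphism with kernel G^{(2,p)}\<close>
    and "profinite_group Q TQ" and "q \<in> hom G Q" and "continuous_map TG TQ q"
    and "q ` carrier G = carrier Q" and "kernel G Q q = lpc G TG p 2"
  shows "T_of G TG (Zmod_p2 p) \<inter> T_of G TG (Mp3 p) = lpc G TG p 3
         \<longleftrightarrow> bock_cup_kernel_condition Q TQ G TG p q"
proof -
  have top: "topological_group G TG" "topological_group Q TQ"
    using assms by (auto simp: profinite_group_def)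
  then have grp: "group G" "group Q" by (auto simp: topological_group_def)
  interpret frattini_quotient G TG p Q TQ q
    by (intro frattini_quotient.intro frattini_quotient_axioms.intro cochains.intro cochains_axioms.intro
        profinite.intro profinite_axioms.intro top_group.intro top_group_axioms.intro grp top assms)
  show ?thesis by (rule T_of_eq_iff_bock_cup_kernel_condition)
qed

end
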